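(* Assume $\mathrm{MA}_{\omega_1}$ (Martin's axiom for $\aleph_1$ many dense sets). Let $\mathfrak F$ be a countable field and let $E$ be an $\mathfrak F$-vector space with a countably infinite basis $(e_n)_{n\in\mathbb N}$. Then every $\boldsymbol\Sigma^1_2$ subset of $E^\infty$ is strategically Ramsey.
   Context: $E$ carries the discrete topology and $E^\infty=E^{\mathbb N}$ the product topology (a Polish space); $\boldsymbol\Sigma^1_2$ (boldface; projections of coanalytic sets) refers to this topology. For $x=\sum a_ne_n\in E$, $\operatorname{supp}x=\{n: a_n\neq0\}$. For non-zero $x,y\in E$, $x<y$ means $n<m$ for all $n\in\operatorname{supp}x$, $m\in\operatorname{supp}y$; for $k\in\mathbb N$, $k<x$ means $k<n$ for all $n\in\operatorname{supp}x$. A (finite, possibly empty, or infinite) sequence $(x_0,x_1,\ldots)$ of non-zero vectors is a block sequence if $x_n<x_{n+1}$ for all $n$. An (infinite-dimensional) block subspace is a subspace spanned by an infinite block sequence. Let $X\subseteq E$ be an infinite-dimensional block subspace and $\vec x$ a finite block sequence. Gowers' game $G_X(\vec x)$: players I and II alternate, I beginning. In round $i$, I plays an infinite-dimensional block subspace $Y_i\subseteq X$, then II plays a non-zero vector $x_i\in Y_i$, subject to $x_0<x_1<x_2<\cdots$. The outcome is the concatenation $\vec x{}^\frown(x_0,x_1,x_2,\ldots)$. Infinite asymptotic game $F_X(\vec x)$: I and II alternate, I beginning. In round $i$, I plays a natural number $n_i$, then II plays a non-zero vector $x_i\in X$ with $n_i<x_i$, subject to $n_0<n_1<\cdots$ and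 $x_0<x_1<\cdots$. The outcome is $\vec x{}^\frown(x_0,x_1,x_2,\ldots)$. A player "has a strategy to play in" a set $\mathbb A\subseteq E^\infty$ if he has a strategy ensuring that the outcome lies in $\mathbb A$. A set $\mathbb A\subseteq E^\infty$ is strategically Ramsey if for every infinite-dimensional block subspace $V\subseteq E$ and every finite block sequence $\vec z$ there is an infinite-dimensional block subspace $W\subseteq V$ such that either II has a strategy in $G_W(\vec z)$ to play in $\mathbb A$, or I has a strategy in $F_W(\vec z)$ to play in $E^\infty\setminus\mathbb A$. *)

theory Defs
  imports "HOL-Analysis.Analysis" "HOL-Library.Omega_Words_Fun"
begin

unbundle cardinal_syntax

section \<open>Martin's axiom for \<open>\<aleph>\<^sub>1\<close> many dense sets\<close>

text \<open>
  A forcing poset is a carrier \<open>P\<close> with a partial order \<open>r\<close>; a pair \<open>(p, q) \<in> r\<close>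
  says that \<open>p\<close> is below (stronger than) \<open>q\<close>.
\<close>

definition compatible_in :: "'p set \<Rightarrow> 'p rel \<Rightarrow> 'p \<Rightarrow> 'p \<Rightarrow> bool" where
  "compatible_in P r p q \<longleftrightarrow> (\<exists>s\<in>P. (s, p) \<in> r \<and> (s, q) \<in> r)"

definition ccc_on :: "'p set \<Rightarrow> 'p rel \<Rightarrow> bool" where
  "ccc_on P r \<longleftrightarrow>
     (\<forall>A\<subseteq>P. (\<forall>p\<in>A. \<forall>q\<in>A. p \<noteq> q \<longrightarrow> \<not> compatible_in P r p q) \<longrightarrow> countable A)"

definition dense_below :: "'p set \<Rightarrow> 'p rel \<Rightarrow> 'p set \<Rightarrow> bool" where
  "dense_below P r d \<longleftrightarrow> d \<subseteq> P \<and> (\<forall>p\<in>P. \<exists>q\<in>d. (q, p) \<in> r)"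

definition filter_on :: "'p set \<Rightarrow> 'p rel \<Rightarrow> 'p set \<Rightarrow> bool" where
  "filter_on P r G \<longleftrightarrow> G \<noteq> {} \<and> G \<subseteq> P
     \<and> (\<forall>p\<in>G. \<forall>q\<in>P. (p, q) \<in> r \<longrightarrow> q \<in> G)
     \<and> (\<forall>p\<in>G. \<forall>q\<in>G. \<exists>s\<in>G. (s, p) \<in> r \<and> (s, q) \<in> r)"

definition martins_axiom_aleph1 :: "'p itself \<Rightarrow> bool" where
  "martins_axiom_aleph1 _ \<longleftrightarrow>
     (\<forall>(P :: 'p set) r \<D>.
        P \<noteq> {} \<longrightarrow> partial_order_on P r \<longrightarrow> ccc_on P r \<longrightarrow>
        |\<D>| \<le>o cardSuc natLeq \<longrightarrow> (\<forall>d\<in>\<D>. dense_below P r d) \<longrightarrow>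
        (\<exists>G. filter_on P r G \<and> (\<forall>d\<in>\<D>. G \<inter> d \<noteq> {})))"

text \<open>
  HOL cannot quantify over all types inside a formula, so the axiom is relative to the
  type in which the posets live. The type \<open>nat set\<close> carries posets of every size up to
  \<open>\<aleph>\<^sub>1\<close> (the cardinal \<open>cardSuc natLeq\<close> is itself a relation on it), and this instance
  implies all the others by passing to a subposet of size at most \<open>\<aleph>\<^sub>1\<close>.
\<close>

lemma ex_subposet_aleph1:
  fixes P :: "'p set"
  assumes p0: "p0 \<in> P" and \<D>: "|\<D>| \<le>o cardSuc natLeq"
    and dense: "\<forall>d\<in>\<D>. dense_below P r d"
  obtains Q where "p0 \<in> Q" "Q \<subseteq> P" "|Q| \<le>o cardSuc natLeq"
    "\<And>d p. d \<in> \<D> \<Longrightarrow> p \<in> Q \<Longrightarrow> \<exists>q\<in>d \<inter> Q. (q, p) \<in> r"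
    "\<And>p q. p \<in> Q \<Longrightarrow> q \<in> Q \<Longrightarrow> compatible_in P r p q \<Longrightarrow> compatible_in Q r p q"
proof -
  let ?k = "cardSuc natLeq"
  have k: "Card_order ?k"
    by (rule cardSuc_Card_order[OF natLeq_Card_order])
  have inf: "\<not> finite (Field ?k)"
    using cardSuc_finite[OF natLeq_Card_order] by (simp add: Field_natLeq)
  have "\<forall>d\<in>\<D>. \<forall>p\<in>P. \<exists>q. q \<in> d \<and> q \<in> P \<and> (q, p) \<in> r"
    using dense unfolding dense_below_def by blast
  then obtain f where f: "\<And>d p. d \<in> \<D> \<Longrightarrow> p \<in> P \<Longrightarrow> f d p \<in> d \<and> f d p \<in> P \<and> (f d p, p) \<in> r"
    by metis
  have "\<forall>p q. \<exists>s. p \<in> P \<longrightarrow> q \<in> P \<longrightarrow> s \<in> P \<and> (compatible_in P r p q \<longrightarrow> (s, p) \<in> r \<and> (s, q) \<in> r)"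
    unfolding compatible_in_def by blast
  then obtain g where g: "\<And>p q. p \<in> P \<Longrightarrow> q \<in> P \<Longrightarrow>
      g p q \<in> P \<and> (compatible_in P r p q \<longrightarrow> (g p q, p) \<in> r \<and> (g p q, q) \<in> r)"
    by metis
  define step where
    "step = (\<lambda>S. S \<union> (\<lambda>(d, p). f d p) ` (\<D> \<times> S) \<union> (\<lambda>(p, q). g p q) ` (S \<times> S))"
  define Qn where "Qn n = (step ^^ n) {p0}" for n
  define Q where "Q = (\<Union>n. Qn n)"
  have Qn_0: "Qn 0 = {p0}" and Qn_Suc: "Qn (Suc n) = step (Qn n)" for n
    by (simp_all add: Qn_def)
  have Qn_P: "Qn n \<subseteq> P" for n
  proof (induction n)
    case (Suc n)
    have "f d p \<in> P" if "d \<in> \<D>" "p \<in> Qn n" for d p using f that Suc by blast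
    moreover have "g p q \<in> P" if "p \<in> Qn n" "q \<in> Qn n" for p q using g that Suc by blast
    ultimately show ?case unfolding Qn_Suc step_def using Suc by (simp add: image_subset_iff)
  qed (simp add: Qn_0 p0)
  have Qn_card: "|Qn n| \<le>o ?k" for n
  proof (induction n)
    case 0
    have "|Qn 0| \<le>o natLeq"
      using ordLess_imp_ordLeq[OF finite_iff_ordLess_natLeq[THEN iffD1, of "{p0}"]] by (simp add: Qn_0)
    then show ?case
      using cardSuc_ordLeq[OF natLeq_Card_order] ordLeq_transitive by blast
  next
    case (Suc n)
    have "|(\<lambda>(d, p). f d p) ` (\<D> \<times> Qn n)| \<le>o ?k" "|(\<lambda>(p, q). g p q) ` (Qn n \<times> Qn n)| \<le>o ?k"
      using card_of_Times_ordLeq_infinite_Field[OF inf _ _ k] \<D> Suc card_of_image ordLeq_transitive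
      by blast+
    then show ?case unfolding Qn_Suc step_def
      using card_of_Un_ordLeq_infinite_Field[OF inf _ _ k] Suc by blast
  qed
  have Qn_mono: "Qn m \<subseteq> Qn n" if "m \<le> n" for m n
    by (rule lift_Suc_mono_le[OF _ that]) (simp add: Qn_Suc step_def Un_assoc)
  show thesis
  proof
    show "p0 \<in> Q" unfolding Q_def using Qn_0 by blast
    show "Q \<subseteq> P" unfolding Q_def using Qn_P by blast
    have "|UNIV :: nat set| \<le>o ?k"
      using ordIso_ordLeq_trans[OF card_of_nat cardSuc_ordLeq[OF natLeq_Card_order]] .
    then show "|Q| \<le>o ?k" unfolding Q_def
      using card_of_UNION_ordLeq_infinite_Field[OF inf k] Qn_card by blast
  next
    fix d p assume d: "d \<in> \<D>" and "p \<in> Q"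
    then obtain n where n: "p \<in> Qn n" unfolding Q_def by blast
    then have "f d p \<in> Qn (Suc n)" unfolding Qn_Suc step_def using d by force
    then show "\<exists>q\<in>d \<inter> Q. (q, p) \<in> r"
      unfolding Q_def using f[OF d] n Qn_P by blast
  next
    fix p q assume "p \<in> Q" "q \<in> Q" and comp: "compatible_in P r p q"
    then obtain m n where "p \<in> Qn m" "q \<in> Qn n" unfolding Q_def by blast
    then have pq: "p \<in> Qn (max m n)" "q \<in> Qn (max m n)"
      using Qn_mono[of m "max m n"] Qn_mono[of n "max m n"] by auto
    then have "g p q \<in> Qn (Suc (max m n))" unfolding Qn_Suc step_def by force
    then show "compatible_in Q r p q"
      unfolding compatible_in_def Q_def using g comp pq Qn_P by blast
  qed
qed

lemma martins_axiom_aleph1_nat_set: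
  assumes MA: "martins_axiom_aleph1 TYPE(nat set)"
  shows "martins_axiom_aleph1 TYPE('p)"
  unfolding martins_axiom_aleph1_def
proof (intro allI impI)
  fix P :: "'p set" and r \<D>
  assume "P \<noteq> {}" and po: "partial_order_on P r" and ccc: "ccc_on P r"
    and \<D>: "|\<D>| \<le>o cardSuc natLeq" and dense: "\<forall>d\<in>\<D>. dense_below P r d"
  have trans: "trans r" and antisym: "antisym r" and rP: "r \<subseteq> P \<times> P" and refl: "refl_on P r"
    using partial_order_onD[OF po] by auto
  obtain p0 where p0: "p0 \<in> P" using \<open>P \<noteq> {}\<close> by blast
  obtain Q where Q: "p0 \<in> Q" "Q \<subseteq> P" "|Q| \<le>o cardSuc natLeq"
    and Qd: "\<And>d p. d \<in> \<D> \<Longrightarrow> p \<in> Q \<Longrightarrow> \<exists>q\<in>d \<inter> Q. (q, p) \<in> r"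
    and Qc: "\<And>p q. p \<in> Q \<Longrightarrow> q \<in> Q \<Longrightarrow> compatible_in P r p q \<Longrightarrow> compatible_in Q r p q"
    using ex_subposet_aleph1[OF p0 \<D> dense] by metis
  have "cardSuc natLeq \<le>o |UNIV :: nat set set|"
    by (rule ordIso_ordLeq_trans[OF ordIso_symmetric[OF card_of_Field_ordIso] card_of_mono1[OF subset_UNIV]])
      (rule cardSuc_Card_order[OF natLeq_Card_order])
  then have "|Q| \<le>o |UNIV :: nat set set|" by (rule ordLeq_transitive[OF Q(3)])
  then obtain h :: "'p \<Rightarrow> nat set" where h: "inj_on h Q"
    unfolding card_of_ordLeq[symmetric] by blast
  define r' where "r' = {(h x, h y) | x y. x \<in> Q \<and> y \<in> Q \<and> (x, y) \<in> r}"
  have r': "(h x, h y) \<in> r' \<longleftrightarrow> (x, y) \<in> r" if "x \<in> Q" "y \<in> Q" for x y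
    unfolding r'_def using inj_on_eq_iff[OF h] that by auto
  have po': "partial_order_on (h ` Q) r'"
    unfolding partial_order_on_def preorder_on_def
  proof (intro conjI)
    show "r' \<subseteq> h ` Q \<times> h ` Q" unfolding r'_def by blast
    show "refl_on (h ` Q) r'"
      using refl Q(2) r' by (auto simp: refl_on_def)
    show "trans r'"
    proof (rule transI)
      fix a b c assume "(a, b) \<in> r'" "(b, c) \<in> r'"
      then obtain x y z where "a = h x" "b = h y" "c = h z" "x \<in> Q" "y \<in> Q" "z \<in> Q"
        "(x, y) \<in> r" "(y, z) \<in> r"
        unfolding r'_def using h by (auto dest: inj_onD)
      then show "(a, c) \<in> r'" using r' trans by (metis transD)
    qed
    show "antisym r'"
    proof (rule antisymI)
      fix a b assume "(a, b) \<in> r'" "(b, a) \<in> r'"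
      then obtain x y where "a = h x" "b = h y" "(x, y) \<in> r" "(y, x) \<in> r"
        unfolding r'_def using h by (auto dest: inj_onD)
      then show "a = b" using antisym by (metis antisymD)
    qed
  qed
  have ccc': "ccc_on (h ` Q) r'"
    unfolding ccc_on_def
  proof (intro allI impI)
    fix A assume A: "A \<subseteq> h ` Q"
      and anti: "\<forall>p\<in>A. \<forall>q\<in>A. p \<noteq> q \<longrightarrow> \<not> compatible_in (h ` Q) r' p q"
    obtain B where B: "B \<subseteq> Q" "A = h ` B" using A by (auto simp: subset_image_iff)
    have "\<not> compatible_in P r p q" if "p \<in> B" "q \<in> B" "p \<noteq> q" for p q
    proof
      assume "compatible_in P r p q"
      then have "compatible_in Q r p q" using Qc that B by blast
      then have "compatible_in (h ` Q) r' (h p) (h q)"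
        unfolding compatible_in_def using r' that B by blast
      moreover have "h p \<noteq> h q" using h that B by (auto dest: inj_onD)
      ultimately show False using anti that B by blast
    qed
    then have "countable B" using ccc B Q(2) unfolding ccc_on_def by (meson subset_trans)
    then show "countable A" using B by simp
  qed
  have dense': "\<forall>d\<in>(\<lambda>d. h ` (d \<inter> Q)) ` \<D>. dense_below (h ` Q) r' d"
  proof
    fix d' assume "d' \<in> (\<lambda>d. h ` (d \<inter> Q)) ` \<D>"
    then obtain d where d: "d \<in> \<D>" "d' = h ` (d \<inter> Q)" by blast
    have "\<exists>q\<in>d'. (q, h p) \<in> r'" if p: "p \<in> Q" for p
      using Qd[OF d(1) p] r' p d(2) by blast
    then show "dense_below (h ` Q) r' d'"
      unfolding dense_below_def using d(2) by blast
  qed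
  have card': "|(\<lambda>d. h ` (d \<inter> Q)) ` \<D>| \<le>o cardSuc natLeq"
    by (rule ordLeq_transitive[OF card_of_image \<D>])
  obtain G' where G': "filter_on (h ` Q) r' G'" and meets: "\<forall>d\<in>\<D>. G' \<inter> h ` (d \<inter> Q) \<noteq> {}"
    using MA[unfolded martins_axiom_aleph1_def, rule_format, OF _ po' ccc' card'] dense' Q(1) by auto
  define H where "H = {x \<in> Q. h x \<in> G'}"
  define G where "G = {p \<in> P. \<exists>x\<in>H. (x, p) \<in> r}"
  have HG: "H \<subseteq> G" unfolding G_def H_def using Q(2) refl by (auto simp: refl_on_def)
  have "H \<noteq> {}" using G' unfolding filter_on_def H_def by blast
  have dir: "\<exists>s\<in>H. (s, x) \<in> r \<and> (s, y) \<in> r" if xy: "x \<in> H" "y \<in> H" for x y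
  proof -
    have "h x \<in> G'" "h y \<in> G'" using xy by (auto simp: H_def)
    then obtain t where t: "t \<in> G'" "(t, h x) \<in> r'" "(t, h y) \<in> r'"
      using G' unfolding filter_on_def by blast
    then obtain s where "s \<in> Q" "t = h s" using G' unfolding filter_on_def by blast
    then show ?thesis using t r' xy by (auto simp: H_def)
  qed
  have "filter_on P r G"
    unfolding filter_on_def
  proof (intro conjI ballI impI)
    show "G \<noteq> {}" using HG \<open>H \<noteq> {}\<close> by blast
    show "G \<subseteq> P" unfolding G_def by blast
  next
    fix p q assume "p \<in> G" "q \<in> P" "(p, q) \<in> r"
    then show "q \<in> G" unfolding G_def using trans by (auto dest: transD)
  next
    fix p q assume "p \<in> G" "q \<in> G"
    then obtain x y where xy: "x \<in> H" "y \<in> H" "(x, p) \<in> r" "(y, q) \<in> r" unfolding G_def by blast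
    then obtain s where "s \<in> H" "(s, x) \<in> r" "(s, y) \<in> r" using dir by blast
    then show "\<exists>s\<in>G. (s, p) \<in> r \<and> (s, q) \<in> r"
      using HG xy trans by (meson subsetD transD)
  qed
  moreover have "\<forall>d\<in>\<D>. G \<inter> d \<noteq> {}"
  proof
    fix d assume "d \<in> \<D>"
    then obtain x where "x \<in> d" "x \<in> Q" "h x \<in> G'" using meets by blast
    then show "G \<inter> d \<noteq> {}" using HG unfolding H_def by blast
  qed
  ultimately show "\<exists>G. filter_on P r G \<and> (\<forall>d\<in>\<D>. G \<inter> d \<noteq> {})" by blast
qed


section \<open>Projective sets\<close>

definition seq_topology :: "(nat \<Rightarrow> 'a) topology" where
  "seq_topology = product_topology (\<lambda>_. discrete_topology UNIV) UNIV"

text \<open>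
  Projections are taken along the Baire space \<open>seq_topology :: (nat \<Rightarrow> nat) topology\<close>.
  The definitions are meant for a Polish space \<open>X\<close>.
\<close>

definition analytic_in :: "'a topology \<Rightarrow> 'a set \<Rightarrow> bool" where
  "analytic_in X A \<longleftrightarrow>
     (\<exists>C. closedin (prod_topology X (seq_topology :: (nat \<Rightarrow> nat) topology)) C \<and> A = fst ` C)"

definition coanalytic_in :: "'a topology \<Rightarrow> 'a set \<Rightarrow> bool" where
  "coanalytic_in X A \<longleftrightarrow> A \<subseteq> topspace X \<and> analytic_in X (topspace X - A)"

definition Sigma_1_2_in :: "'a topology \<Rightarrow> 'a set \<Rightarrow> bool" where
  "Sigma_1_2_in X A \<longleftrightarrow>
     (\<exists>C. coanalytic_in (prod_topology X (seq_topology :: (nat \<Rightarrow> nat) topology)) C \<and> A = fst ` C)"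


section \<open>Block sequences, games and strategically Ramsey sets\<close>

locale vector_space_with_basis = vector_space scale
  for scale :: "'f::field \<Rightarrow> 'e::ab_group_add \<Rightarrow> 'e" +
  fixes e :: "nat \<Rightarrow> 'e"
  assumes inj_basis: "inj e"
    and independent_basis: "independent (range e)"
    and span_basis: "span (range e) = UNIV"
begin

definition supp :: "'e \<Rightarrow> nat set" where
  "supp x = {n. representation (range e) x (e n) \<noteq> 0}"

definition block_less :: "'e \<Rightarrow> 'e \<Rightarrow> bool" (infix \<open>\<lless>\<close> 50) where
  "x \<lless> y \<longleftrightarrow> (\<forall>n\<in>supp x. \<forall>m\<in>supp y. n < m)"

definition nat_less :: "nat \<Rightarrow> 'e \<Rightarrow> bool" where
  "nat_less k x \<longleftrightarrow> (\<forall>n\<in>supp x. k < n)"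

definition fin_block_seq :: "'e list \<Rightarrow> bool" where
  "fin_block_seq xs \<longleftrightarrow> 0 \<notin> set xs \<and> successively (\<lless>) xs"

definition block_seq :: "(nat \<Rightarrow> 'e) \<Rightarrow> bool" where
  "block_seq x \<longleftrightarrow> (\<forall>i. x i \<noteq> 0) \<and> (\<forall>i. x i \<lless> x (Suc i))"

definition block_subspace :: "'e set \<Rightarrow> bool" where
  "block_subspace Y \<longleftrightarrow> (\<exists>b. block_seq b \<and> Y = span (range b))"

text \<open>
  A strategy maps the finite list of the opponent's previous moves to the next move; the
  player's own previous moves are determined by these. It suffices to test a strategy
  against infinite legal sequences of opponent's moves: in both games the opponent is never
  left without a legal move, so every finite sequence of legal moves of his extends to an
  infinite one.
\<close>

definition II_has_strategy_G :: "'e set \<Rightarrow> 'e list \<Rightarrow> (nat \<Rightarrow> 'e) set \<Rightarrow> bool" where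
  "II_has_strategy_G X z \<A> \<longleftrightarrow>
     (\<exists>\<sigma> :: 'e set list \<Rightarrow> 'e. \<forall>Y x.
        (\<forall>i. block_subspace (Y i) \<and> Y i \<subseteq> X) \<longrightarrow>
        (\<forall>i. x i = \<sigma> (map Y [0..<Suc i])) \<longrightarrow>
        (\<forall>i. x i \<noteq> 0 \<and> x i \<in> Y i \<and> x i \<lless> x (Suc i)) \<and> z \<frown> x \<in> \<A>)"

definition I_has_strategy_F :: "'e set \<Rightarrow> 'e list \<Rightarrow> (nat \<Rightarrow> 'e) set \<Rightarrow> bool" where
  "I_has_strategy_F X z \<A> \<longleftrightarrow>
     (\<exists>\<tau> :: 'e list \<Rightarrow> nat. \<forall>n x.
        (\<forall>i. n i = \<tau> (map x [0..<i])) \<longrightarrow>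
        (\<forall>i. x i \<noteq> 0 \<and> x i \<in> X \<and> nat_less (n i) (x i) \<and> x i \<lless> x (Suc i)) \<longrightarrow>
        (\<forall>i. n i < n (Suc i)) \<and> z \<frown> x \<in> \<A>)"

definition strategically_Ramsey :: "(nat \<Rightarrow> 'e) set \<Rightarrow> bool" where
  "strategically_Ramsey \<A> \<longleftrightarrow>
     (\<forall>V z. block_subspace V \<longrightarrow> fin_block_seq z \<longrightarrow>
        (\<exists>W. block_subspace W \<and> W \<subseteq> V \<and>
           (II_has_strategy_G W z \<A> \<or> I_has_strategy_F W z (- \<A>))))"

end

end

theory Submission
  imports Defs "HOL-Library.Sublist"
begin

text \<open>
  A \<open>\<Sigma>\<^sup>1\<^sub>2\<close> set is the projection of the branches of a tree on \<open>E \<times> \<aleph>\<^sub>1\<close> (Shoenfield), so it is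
  the set \<open>A' []\<close> of a system with \<open>A' s \<subseteq> (\<Union>\<xi>. A' (s @ [\<xi>]))\<close> indexed by the nodes of a tree
  of size \<open>\<aleph>\<^sub>1\<close>. Gowers' combinatorial forcing then works for this system as in the analytic case,
  the two uses of countability being replaced by consequences of Martin's axiom. First, a
  decreasing \<open>\<aleph>\<^sub>1\<close>-chain of block subspaces modulo finite has a pseudo-intersection; hence some
  \<open>U\<close> decides, for all positions \<open>q\<close> and nodes \<open>s\<close> at once, whether I can avoid \<open>A' s\<close> from \<open>q\<close>.
  Secondly, \<open>\<aleph>\<^sub>1\<close> many strategies of I are dominated by a single one modulo finite; hence if I can
  avoid all positions from which some \<open>A' (s @ [\<xi>])\<close> is unavoidable, then he can avoid all the
  \<open>A' (s @ [\<xi>])\<close> simultaneously and so \<open>A' s\<close>. If \<open>A' []\<close> is unavoidable, II therefore moves from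
  one unavoidable node to a child of it forever, building a branch of the tree.
\<close>

section \<open>Sets of size at most \<open>\<aleph>\<^sub>1\<close>\<close>

lemma prefix_nth: "prefix xs ys \<Longrightarrow> i < length xs \<Longrightarrow> ys ! i = xs ! i"
  by (auto simp: prefix_def nth_append)

lemma card_of_le_aleph1_if_countable:
  assumes "countable A"
  shows "|A| \<le>o cardSuc natLeq"
proof -
  have "|A| \<le>o |UNIV :: nat set|"
    using assms unfolding countable_def card_of_ordLeq[symmetric] by blast
  then show ?thesis
    by (rule ordLeq_ordIso_trans[OF _ card_of_nat, THEN ordLeq_transitive])
      (rule cardSuc_ordLeq[OF natLeq_Card_order])
qed

lemma infinite_Field_aleph1: "infinite (Field (cardSuc natLeq))"
  using cardSuc_finite[OF natLeq_Card_order] by (simp add: Field_natLeq)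

lemma Card_order_aleph1: "Card_order (cardSuc natLeq)"
  by (rule cardSuc_Card_order[OF natLeq_Card_order])

lemma card_of_Times_le_aleph1:
  "|A| \<le>o cardSuc natLeq \<Longrightarrow> |B| \<le>o cardSuc natLeq \<Longrightarrow> |A \<times> B| \<le>o cardSuc natLeq"
  by (rule card_of_Times_ordLeq_infinite_Field[OF infinite_Field_aleph1 _ _ Card_order_aleph1])

lemma card_of_Un_le_aleph1:
  "|A| \<le>o cardSuc natLeq \<Longrightarrow> |B| \<le>o cardSuc natLeq \<Longrightarrow> |A \<union> B| \<le>o cardSuc natLeq"
  by (rule card_of_Un_ordLeq_infinite_Field[OF infinite_Field_aleph1 _ _ Card_order_aleph1])

lemma card_of_image_le_aleph1: "|A| \<le>o cardSuc natLeq \<Longrightarrow> |f ` A| \<le>o cardSuc natLeq"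
  by (rule ordLeq_transitive[OF card_of_image])

lemma card_of_lists_le_aleph1:
  assumes "|A| \<le>o cardSuc natLeq"
  shows "|lists A| \<le>o cardSuc natLeq"
proof -
  let ?k = "cardSuc natLeq"
  have "|{xs \<in> lists A. length xs = n}| \<le>o ?k" for n
  proof (induction n)
    case 0
    have "{xs \<in> lists A. length xs = 0} \<subseteq> {[]}" by auto
    then show ?case by (meson card_of_le_aleph1_if_countable countable_finite finite.simps finite_subset)
  next
    case (Suc n)
    have "{xs \<in> lists A. length xs = Suc n} \<subseteq> (\<lambda>(x, xs). x # xs) ` (A \<times> {xs \<in> lists A. length xs = n})"
      by (auto simp: length_Suc_conv)
    moreover have "|A \<times> {xs \<in> lists A. length xs = n}| \<le>o ?k"
      by (rule card_of_Times_le_aleph1[OF assms Suc])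
    ultimately show ?case
      using ordLeq_transitive[OF card_of_mono1 ordLeq_transitive[OF card_of_image]] by blast
  qed
  then have "|\<Union>n. {xs \<in> lists A. length xs = n}| \<le>o ?k"
    by (intro card_of_UNION_ordLeq_infinite_Field[OF infinite_Field_aleph1 Card_order_aleph1
          card_of_le_aleph1_if_countable] ballI) simp_all
  moreover have "lists A = (\<Union>n. {xs \<in> lists A. length xs = n})" by auto
  ultimately show ?thesis by simp
qed

section \<open>Consequences of Martin's axiom\<close>

text \<open>The common source of both uses of Martin's axiom. A condition is a finite stem
  \<open>s\<close> with a finite set \<open>F\<close> of promises, and every entry added later must
  keep the promises already made. Stems range over a countable set, which gives ccc; a promise
  \<open>c\<close> is kept from the stage at which it enters the generic filter.\<close>

lemma MA_generic_sequence:
  fixes R :: "'c \<Rightarrow> 'x list \<Rightarrow> 'x \<Rightarrow> bool"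
  assumes MA: "martins_axiom_aleph1 TYPE(nat set)"
    and ctbl: "countable (UNIV :: 'x set)"
    and C: "|C| \<le>o cardSuc natLeq"
    and ext: "\<And>F s. finite F \<Longrightarrow> F \<subseteq> C \<Longrightarrow> \<exists>x. \<forall>c\<in>F. R c s x"
  obtains b where "\<And>c. c \<in> C \<Longrightarrow> \<exists>k. \<forall>i\<ge>k. R c (map b [0..<i]) (b i)"
proof -
  define P :: "('x list \<times> 'c set) set" where "P = {(s, F). finite F \<and> F \<subseteq> C}"
  define r where "r = {((t, G), (s, F)). (t, G) \<in> P \<and> (s, F) \<in> P \<and> prefix s t \<and> F \<subseteq> G \<and>
    (\<forall>c\<in>F. \<forall>i. length s \<le> i \<longrightarrow> i < length t \<longrightarrow> R c (take i t) (t ! i))}"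
  have r_iff: "((t, G), (s, F)) \<in> r \<longleftrightarrow> (t, G) \<in> P \<and> (s, F) \<in> P \<and> prefix s t \<and> F \<subseteq> G \<and>
    (\<forall>c\<in>F. \<forall>i. length s \<le> i \<longrightarrow> i < length t \<longrightarrow> R c (take i t) (t ! i))" for s t F G
    by (simp add: r_def)
  have po: "partial_order_on P r"
    unfolding partial_order_on_def preorder_on_def
  proof (intro conjI)
    show "r \<subseteq> P \<times> P" by (auto simp: r_def)
    show "refl_on P r" by (auto simp: refl_on_def r_def)
    show "antisym r" by (auto simp: antisym_def r_def intro: prefix_order.antisym)
    show "trans r"
    proof (rule transI, clarify)
      fix u H t G s F
      assume 1: "((u, H), (t, G)) \<in> r" and 2: "((t, G), (s, F)) \<in> r"
      have "R c (take i u) (u ! i)" if c: "c \<in> F" and i: "length s \<le> i" "i < length u" for c i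
      proof (cases "i < length t")
        case True
        obtain v where v: "u = t @ v" using 1 by (auto simp: r_iff prefix_def)
        have "R c (take i t) (t ! i)" using 2 c i True by (simp add: r_iff)
        then show ?thesis using True by (simp add: v nth_append)
      next
        case False
        moreover have "c \<in> G" using 2 c by (auto simp: r_iff)
        ultimately show ?thesis using 1 i by (simp add: r_iff)
      qed
      then show "((u, H), (s, F)) \<in> r" using 1 2 by (auto simp: r_iff)
    qed
  qed
  have ccc: "ccc_on P r"
    unfolding ccc_on_def
  proof (intro allI impI)
    fix A assume A: "A \<subseteq> P" and anti: "\<forall>p\<in>A. \<forall>q\<in>A. p \<noteq> q \<longrightarrow> \<not> compatible_in P r p q"
    \<comment> \<open>Two conditions with the same stem are compatible through the union of their
      promises, so an antichain has at most one condition per stem.\<close>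
    have "inj_on fst A"
    proof (rule inj_onI, rule ccontr)
      fix p q assume pq: "p \<in> A" "q \<in> A" "fst p = fst q" "p \<noteq> q"
      obtain s F G where s: "p = (s, F)" "q = (s, G)" using pq by (metis prod.collapse)
      have "(s, F) \<in> P" "(s, G) \<in> P" using A pq s by auto
      then have "(s, F \<union> G) \<in> P" "((s, F \<union> G), p) \<in> r" "((s, F \<union> G), q) \<in> r"
        by (auto simp: s r_iff P_def)
      then show False using anti pq unfolding compatible_in_def by blast
    qed
    moreover have "countable (UNIV :: 'x list set)"
      using countable_lists[OF ctbl] by simp
    ultimately show "countable A"
      by (meson countable_image_inj_on countable_subset subset_UNIV)
  qed
  \<comment> \<open>Hypothesis \<open>ext\<close> supplies one entry that keeps all the finitely
    many promises in \<open>F\<close>.\<close>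
  have extend: "\<exists>t. ((t, F), (s, F)) \<in> r \<and> length t = Suc (length s)" if sF: "(s, F) \<in> P" for s F
  proof -
    obtain x where "\<forall>c\<in>F. R c s x" using ext[of F s] sF by (auto simp: P_def)
    moreover have "(s @ [x], F) \<in> P" using sF by (simp add: P_def)
    ultimately have "((s @ [x], F), (s, F)) \<in> r" using sF by (auto simp: r_iff less_Suc_eq)
    then show ?thesis by (intro exI[of _ "s @ [x]"]) simp
  qed
  define DC where "DC c = {(s :: 'x list, F). (s, F) \<in> P \<and> c \<in> F}" for c
  define DL where "DL n = {(s :: 'x list, F). (s, F) \<in> P \<and> n \<le> length s}" for n
  have DC: "dense_below P r (DC c)" if c: "c \<in> C" for c
    unfolding dense_below_def
  proof (intro conjI ballI)
    fix p assume p: "p \<in> P"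
    obtain s F where s: "p = (s, F)" by force
    have "(s, insert c F) \<in> DC c" "((s, insert c F), p) \<in> r"
      using p c by (auto simp: s DC_def r_iff P_def)
    then show "\<exists>q\<in>DC c. (q, p) \<in> r" by blast
  qed (auto simp: DC_def)
  have tr: "trans r" and rf: "refl_on P r" using partial_order_onD[OF po] by auto
  have DL: "dense_below P r (DL n)" for n
    unfolding dense_below_def
  proof (intro conjI ballI)
    fix p assume p: "p \<in> P"
    obtain s F where s: "p = (s, F)" by force
    have "\<exists>t. ((t, F), (s, F)) \<in> r \<and> m \<le> length t" for m
    proof (induction m)
      case 0 then show ?case using p s rf by (auto simp: refl_on_def)
    next
      case (Suc m)
      then obtain t where t: "((t, F), (s, F)) \<in> r" "m \<le> length t" by blast
      then obtain u where "((u, F), (t, F)) \<in> r" "length u = Suc (length t)"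
        using extend by (metis r_iff)
      then show ?case using t tr by (metis Suc_le_mono transD)
    qed
    then obtain t where "((t, F), (s, F)) \<in> r" "n \<le> length t" by blast
    then show "\<exists>q\<in>DL n. (q, p) \<in> r" using s by (auto simp: DL_def r_iff)
  qed (auto simp: DL_def)
  define D where "D = DC ` C \<union> range DL"
  have "|D| \<le>o cardSuc natLeq"
    unfolding D_def by (intro card_of_Un_le_aleph1 card_of_image_le_aleph1 C card_of_le_aleph1_if_countable) simp
  moreover have "P \<noteq> {}" by (auto simp: P_def)
  moreover have "\<forall>d\<in>D. dense_below P r d" using DC DL by (auto simp: D_def)
  ultimately have "\<exists>G. filter_on P r G \<and> (\<forall>d\<in>D. G \<inter> d \<noteq> {})"
    using martins_axiom_aleph1_nat_set[OF MA, unfolded martins_axiom_aleph1_def,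
        THEN spec, of P, THEN spec, of r, THEN spec, of D] po ccc by argo
  then obtain G where G: "filter_on P r G" "\<forall>d\<in>D. G \<inter> d \<noteq> {}" by blast
  have dir: "\<exists>u H. (u, H) \<in> G \<and> ((u, H), (s, F)) \<in> r \<and> ((u, H), (t, F')) \<in> r"
    if "(s, F) \<in> G" "(t, F') \<in> G" for s t F F'
  proof -
    have "\<exists>p\<in>G. (p, (s, F)) \<in> r \<and> (p, (t, F')) \<in> r"
      using G(1) that unfolding filter_on_def by blast
    then show ?thesis by (metis surj_pair)
  qed
  have "\<exists>s F. (s, F) \<in> G \<and> n \<le> length s" for n
  proof -
    have "G \<inter> DL n \<noteq> {}" using G(2) unfolding D_def by blast
    then show ?thesis by (auto simp: DL_def)
  qed
  then obtain S \<F> where S: "\<And>n. (S n, \<F> n) \<in> G" "\<And>n. n \<le> length (S n)" by metis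
  \<comment> \<open>\<open>S (Suc i)\<close> has length at least \<open>Suc i\<close>, so the index
    is in range; directedness of \<open>G\<close> makes the entry the same for all long enough stems
    in \<open>G\<close>.\<close>
  define b where "b i = S (Suc i) ! i" for i
  have b: "s ! i = b i" if sF: "(s, F) \<in> G" "i < length s" for s F i
  proof -
    obtain u H where "((u, H), (s, F)) \<in> r" "((u, H), (S (Suc i), \<F> (Suc i))) \<in> r"
      using dir[OF sF(1) S(1)] by blast
    then have "prefix s u" "prefix (S (Suc i)) u" by (auto simp: r_iff)
    then have "s ! i = u ! i" "S (Suc i) ! i = u ! i"
      using sF(2) S(2)[of "Suc i"] by (metis nth_append prefix_def Suc_le_eq)+
    then show ?thesis by (simp add: b_def)
  qed
  show thesis
  proof (rule that)
    fix c assume c: "c \<in> C"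
    then have "G \<inter> DC c \<noteq> {}" using G(2) unfolding D_def by blast
    \<comment> \<open>The length of this stem serves as \<open>k\<close>: afterwards every entry of
      \<open>b\<close> obeys the promise \<open>c\<close>.\<close>
    then obtain s F where s: "(s, F) \<in> G" "c \<in> F" by (auto simp: DC_def)
    have "R c (map b [0..<i]) (b i)" if i: "length s \<le> i" for i
    proof -
      obtain u H where u: "(u, H) \<in> G" "((u, H), (s, F)) \<in> r" "((u, H), (S (Suc i), \<F> (Suc i))) \<in> r"
        using dir[OF s(1) S(1)] by blast
      then have "prefix (S (Suc i)) u" by (auto simp: r_iff)
      then have len: "i < length u" using S(2)[of "Suc i"] prefix_length_le by fastforce
      then have "R c (take i u) (u ! i)" using u(2) s(2) i by (auto simp: r_iff)
      moreover have "take i u = map b [0..<i]" using len b[OF u(1)] by (intro nth_equalityI) auto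
      ultimately show ?thesis using b[OF u(1) len] by simp
    qed
    then show "\<exists>k. \<forall>i\<ge>k. R c (map b [0..<i]) (b i)" by blast
  qed
qed

text \<open>A generic sequence of numbers along an enumeration of \<open>'x\<close>: the promise for
  \<open>f\<close> is that the entry at \<open>i\<close> is at least the value of \<open>f\<close>
  at the \<open>i\<close>-th point. Only the points enumerated before the promise is made can be
  exceptions.\<close>

lemma ex_dominating_function:
  fixes H :: "('x \<Rightarrow> nat) set"
  assumes MA: "martins_axiom_aleph1 TYPE(nat set)"
    and ctbl: "countable (UNIV :: 'x set)"
    and H: "|H| \<le>o cardSuc natLeq"
  obtains g where "\<And>f. f \<in> H \<Longrightarrow> finite {x. g x < f x}"
proof -
  \<comment> \<open>Finitely many functions are bounded at a point by the sum of their values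
    there.\<close>
  have ex: "\<exists>x. \<forall>f\<in>F. f (from_nat_into (UNIV :: 'x set) (length s)) \<le> x"
    if "finite F" "F \<subseteq> H" for F :: "('x \<Rightarrow> nat) set" and s :: "nat list"
    using that(1) by (intro exI[of _ "\<Sum>f\<in>F. f (from_nat_into UNIV (length s))"] ballI)
      (rule member_le_sum[where f = "\<lambda>f. f (from_nat_into UNIV (length s))"], auto)
  obtain b :: "nat \<Rightarrow> nat" where b: "\<And>f. f \<in> H \<Longrightarrow> \<exists>k. \<forall>i\<ge>k. f (from_nat_into UNIV i) \<le> b i"
    using MA_generic_sequence[OF MA _ H, of "\<lambda>f s x. f (from_nat_into UNIV (length s)) \<le> x"] ex by auto
  show thesis
  proof (rule that)
    fix f assume "f \<in> H"
    then obtain k where k: "\<And>i. k \<le> i \<Longrightarrow> f (from_nat_into UNIV i) \<le> b i" using b by blast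
    have "{x. (b \<circ> to_nat_on UNIV) x < f x} \<subseteq> from_nat_into UNIV ` {..<k}"
    proof
      fix x assume "x \<in> {x. (b \<circ> to_nat_on UNIV) x < f x}"
      then have "b (to_nat_on UNIV x) < f (from_nat_into UNIV (to_nat_on UNIV x))"
        using from_nat_into_to_nat_on[OF ctbl, of x] by simp
      then have "to_nat_on UNIV x < k" using k linorder_not_le by (metis)
      then show "x \<in> from_nat_into UNIV ` {..<k}"
        using from_nat_into_to_nat_on[OF ctbl, of x] by (metis UNIV_I imageI lessThan_iff)
    qed
    then show "finite {x. (b \<circ> to_nat_on UNIV) x < f x}"
      by (rule finite_subset) simp
  qed
qed

section \<open>The Shoenfield tree\<close>

text \<open>This is the regularity of \<open>\<aleph>\<^sub>1\<close>, applied to the increasing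
  chain of its initial segments.\<close>

lemma ex_aleph1_strict_bound:
  assumes "countable B" "B \<subseteq> Field (cardSuc natLeq)"
  shows "\<exists>i\<in>Field (cardSuc natLeq). \<forall>b\<in>B. (b, i) \<in> cardSuc natLeq - Id"
proof -
  let ?r = "cardSuc natLeq"
  have wo: "Well_order ?r" by (rule cardSuc_Well_order[OF natLeq_Card_order])
  then have tr: "trans ?r" and an: "antisym ?r"
    by (simp_all add: well_order_on_def linear_order_on_def partial_order_on_def preorder_on_def)
  have "relChain ?r (underS ?r)"
    unfolding relChain_def underS_def using tr an by (auto dest: transD antisymD)
  moreover have "B \<subseteq> (\<Union>i\<in>Field ?r. underS ?r i)"
    using infinite_Card_order_limit[OF Card_order_aleph1 infinite_Field_aleph1] assms(2)
    by (fastforce simp: underS_def)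
  moreover have "|B| \<le>o natLeq"
    using assms(1) card_of_ordLeq[of B "UNIV :: nat set"] ordLeq_ordIso_trans[OF _ card_of_nat]
    unfolding countable_def by blast
  ultimately have "\<exists>i\<in>Field ?r. B \<subseteq> underS ?r i"
    by (intro cardSuc_UNION[OF natLeq_Card_order]) (simp_all add: Field_natLeq)
  then show ?thesis unfolding underS_def by blast
qed

text \<open>A point has only countably many predecessors, so a rank above all of theirs still exists
  below \<open>\<aleph>\<^sub>1\<close> and the recursion never stops. Conversely, a rank function
  pulls back the well-founded order of the ordinals.\<close>

lemma wf_iff_ex_aleph1_rank:
  fixes r :: "('a :: countable) rel"
  shows "wf r \<longleftrightarrow> (\<exists>h. range h \<subseteq> Field (cardSuc natLeq) \<and> (\<forall>a b. (a, b) \<in> r \<longrightarrow> (h a, h b) \<in> cardSuc natLeq - Id))"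
    (is "_ \<longleftrightarrow> ?R")
proof
  assume wf: "wf r"
  have "\<exists>h. \<forall>b. h b \<in> Field (cardSuc natLeq) \<and> (\<forall>a. (a, b) \<in> r \<longrightarrow> (h a, h b) \<in> cardSuc natLeq - Id)"
  proof (rule dependent_wf_choice[OF wf])
    fix h b
    assume h: "\<And>a. (a, b) \<in> r \<Longrightarrow> h a \<in> Field (cardSuc natLeq) \<and>
      (\<forall>c. (c, a) \<in> r \<longrightarrow> (h c, h a) \<in> cardSuc natLeq - Id)"
    have "countable (h ` {a. (a, b) \<in> r})" by simp
    moreover have "h ` {a. (a, b) \<in> r} \<subseteq> Field (cardSuc natLeq)" using h by blast
    ultimately obtain v where "v \<in> Field (cardSuc natLeq)"
      "\<forall>c\<in>h ` {a. (a, b) \<in> r}. (c, v) \<in> cardSuc natLeq - Id"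
      using ex_aleph1_strict_bound[of "h ` {a. (a, b) \<in> r}"] by blast
    then show "\<exists>v. v \<in> Field (cardSuc natLeq) \<and> (\<forall>a. (a, b) \<in> r \<longrightarrow> (h a, v) \<in> cardSuc natLeq - Id)"
      by (intro exI[of _ v]) simp
  qed auto
  then show ?R by blast
next
  assume ?R
  then obtain h where "\<forall>a b. (a, b) \<in> r \<longrightarrow> (h a, h b) \<in> cardSuc natLeq - Id" by blast
  then have "r \<subseteq> inv_image (cardSuc natLeq - Id) h" by (auto simp: inv_image_def)
  moreover have "wf (cardSuc natLeq - Id)"
    using cardSuc_Well_order[OF natLeq_Card_order] by (simp add: well_order_on_def)
  ultimately show "wf r" using wf_inv_image wf_subset by blast
qed

lemma topspace_seq_topology [simp]: "topspace seq_topology = UNIV"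
  by (simp add: seq_topology_def)

lemma openin_seq_topologyD:
  assumes "openin seq_topology S" "x \<in> S"
  shows "\<exists>n. \<forall>y. map y [0..<n] = map x [0..<n] \<longrightarrow> y \<in> S"
proof -
  obtain U where U: "finite {i. U i \<noteq> UNIV}" "x \<in> (\<Pi>\<^sub>E i\<in>UNIV. U i)" "(\<Pi>\<^sub>E i\<in>UNIV. U i) \<subseteq> S"
    using assms unfolding seq_topology_def openin_product_topology_alt by auto
  obtain n where n: "\<And>i. U i \<noteq> UNIV \<Longrightarrow> i < n" using U(1) by (auto simp: finite_nat_set_iff_bounded)
  show ?thesis
  proof (intro exI[of _ n] allI impI)
    fix y assume "map y [0..<n] = map x [0..<n]"
    then have "y i = x i" if "i < n" for i using that by simp
    then have "y \<in> (\<Pi>\<^sub>E i\<in>UNIV. U i)" using U(2) n by (auto simp: PiE_iff) (metis UNIV_I)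
    then show "y \<in> S" using U(3) by blast
  qed
qed

lemma map_upt_eq_if_le: "l \<le> m \<Longrightarrow> map u [0..<m] = map v [0..<m] \<Longrightarrow> map u [0..<l] = map v [0..<l]"
  by simp

text \<open>Basic open sets restrict finitely many coordinates, so a point whose initial segments of
  unbounded lengths are met by \<open>D\<close> cannot have a neighbourhood in the
  complement.\<close>

lemma closedin_seq_topology3D:
  assumes D: "closedin (prod_topology (prod_topology seq_topology seq_topology) seq_topology) D"
    and approx: "\<And>n. \<exists>m x' y' w'. n \<le> m \<and> ((x', y'), w') \<in> D \<and> map x' [0..<m] = map x [0..<m] \<and>
      map y' [0..<m] = map y [0..<m] \<and> map w' [0..<m] = map w [0..<m]"
  shows "((x, y), w) \<in> D"
proof (rule ccontr)
  let ?T = "prod_topology (prod_topology seq_topology seq_topology) seq_topology"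
  assume "((x, y), w) \<notin> D"
  then have "((x, y), w) \<in> topspace ?T - D" by simp
  moreover have "openin ?T (topspace ?T - D)" using D by blast
  ultimately obtain U Z where Z: "openin seq_topology Z" "w \<in> Z" "U \<times> Z \<subseteq> topspace ?T - D"
    and "openin (prod_topology seq_topology seq_topology) U" "(x, y) \<in> U"
    using openin_prod_topology_alt[THEN iffD1, rule_format] by (metis (no_types))
  then obtain X Y where X: "openin seq_topology X" "x \<in> X" and Y: "openin seq_topology Y" "y \<in> Y"
    and XY: "X \<times> Y \<subseteq> U"
    using openin_prod_topology_alt[THEN iffD1, rule_format] by (metis (no_types))
  obtain i where i: "\<forall>x'. map x' [0..<i] = map x [0..<i] \<longrightarrow> x' \<in> X" using openin_seq_topologyD[OF X] by blast
  obtain j where j: "\<forall>y'. map y' [0..<j] = map y [0..<j] \<longrightarrow> y' \<in> Y" using openin_seq_topologyD[OF Y] by blast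
  obtain k where k: "\<forall>w'. map w' [0..<k] = map w [0..<k] \<longrightarrow> w' \<in> Z" using openin_seq_topologyD[OF Z(1,2)] by blast
  obtain m x' y' w' where m: "max i (max j k) \<le> m" "((x', y'), w') \<in> D"
    "map x' [0..<m] = map x [0..<m]" "map y' [0..<m] = map y [0..<m]" "map w' [0..<m] = map w [0..<m]"
    using approx[of "max i (max j k)"] by blast
  have "x' \<in> X" by (rule i[rule_format], rule map_upt_eq_if_le[OF _ m(3)]) (use m(1) in simp)
  moreover have "y' \<in> Y" by (rule j[rule_format], rule map_upt_eq_if_le[OF _ m(4)]) (use m(1) in simp)
  moreover have "w' \<in> Z" by (rule k[rule_format], rule map_upt_eq_if_le[OF _ m(5)]) (use m(1) in simp)
  ultimately show False using XY Z(3) m(2) by blast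
qed

text \<open>The Shoenfield tree: a point \<open>(x, y)\<close> lies in a coanalytic set iff its section of the
  tree of the complement has a rank function into \<open>\<aleph>\<^sub>1\<close>. The branch \<open>f\<close> records \<open>y\<close> and
  this rank function.\<close>

theorem Sigma_1_2_in_souslin:
  fixes A :: "(nat \<Rightarrow> 'a) set"
  assumes "Sigma_1_2_in seq_topology A"
  obtains K :: "(nat \<times> nat set) set" and R :: "'a list \<Rightarrow> (nat \<times> nat set) list \<Rightarrow> bool"
  where "|K| \<le>o cardSuc natLeq"
    and "A = {x. \<exists>f. (\<forall>n. f n \<in> K) \<and> (\<forall>n. R (map x [0..<n]) (map f [0..<n]))}"
proof -
  let ?S = "seq_topology :: (nat \<Rightarrow> nat) topology"
  let ?r = "cardSuc natLeq"
  obtain C where C: "coanalytic_in (prod_topology seq_topology ?S) C" "A = fst ` C"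
    using assms unfolding Sigma_1_2_in_def by blast
  then obtain D where D: "closedin (prod_topology (prod_topology seq_topology ?S) ?S) D" "- C = fst ` D"
    unfolding coanalytic_in_def analytic_in_def by (auto simp: Compl_eq_Diff_UNIV)
  \<comment> \<open>The tree of initial segments of points of the closed set
    \<open>D\<close>.\<close>
  define T where "T u v t \<longleftrightarrow> (\<exists>x y w. ((x, y), w) \<in> D \<and> map x [0..<length t] = u \<and>
    map y [0..<length t] = v \<and> map w [0..<length t] = t)" for u v and t :: "nat list"
  \<comment> \<open>Children lie below their parents in the section of the tree at
    \<open>(x, y)\<close>, so a descending chain is an infinite branch.\<close>
  define E where "E x y = {(t @ [a], t) | t a.
    T (map x [0..<Suc (length t)]) (map y [0..<Suc (length t)]) (t @ [a])}" for x y
  have wf_E: "(x, y) \<in> C \<longleftrightarrow> wf (E x y)" for x y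
  proof
    assume xy: "(x, y) \<in> C"
    show "wf (E x y)"
      unfolding wf_iff_no_infinite_down_chain
    proof
      assume "\<exists>s. \<forall>i. (s (Suc i), s i) \<in> E x y"
      then obtain s where s: "\<And>i. (s (Suc i), s i) \<in> E x y" by blast
      have s_Suc: "\<exists>a. s (Suc i) = s i @ [a]" for i using s[of i] by (auto simp: E_def)
      have len: "length (s i) = length (s 0) + i" for i
      proof (induction i)
        case (Suc i) then show ?case using s_Suc[of i] by auto
      qed simp
      have mono: "prefix (s i) (s j)" if "i \<le> j" for i j
        using that
      proof (induction j rule: dec_induct)
        case (step j)
        then show ?case using s_Suc[of j] by (auto intro: prefix_order.trans)
      qed simp
      \<comment> \<open>The chain may start above the root; \<open>s (Suc i)\<close> is longer than
        \<open>i\<close> in any case, so it determines the entry at \<open>i\<close>.\<close>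
      define w where "w i = s (Suc i) ! i" for i
      have w: "map w [0..<length (s j)] = s j" for j
      proof (rule nth_equalityI)
        fix i assume "i < length (map w [0..<length (s j)])"
        then have i: "i < length (s j)" by simp
        have "s (Suc i) ! i = s j ! i"
        proof (cases "j \<le> Suc i")
          case True
          then show ?thesis by (rule prefix_nth[OF mono i])
        next
          case False
          then have "prefix (s (Suc i)) (s j)" by (intro mono) simp
          moreover have "i < length (s (Suc i))" unfolding len[of "Suc i"] by simp
          ultimately have "s j ! i = s (Suc i) ! i" by (rule prefix_nth)
          then show ?thesis by (rule sym)
        qed
        then show "map w [0..<length (s j)] ! i = s j ! i" using i by (simp add: w_def)
      qed simp
      have "((x, y), w) \<in> D"
      proof (rule closedin_seq_topology3D[OF D(1)])
        fix n
        let ?m = "length (s (Suc n))"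
        have "T (map x [0..<?m]) (map y [0..<?m]) (s (Suc n))" using s[of n] by (auto simp: E_def)
        then obtain x' y' w' where "((x', y'), w') \<in> D" "map x' [0..<?m] = map x [0..<?m]"
          "map y' [0..<?m] = map y [0..<?m]" "map w' [0..<?m] = s (Suc n)" unfolding T_def by blast
        moreover have "n \<le> ?m" using len[of "Suc n"] by simp
        ultimately show "\<exists>m x' y' w'. n \<le> m \<and> ((x', y'), w') \<in> D \<and> map x' [0..<m] = map x [0..<m] \<and>
            map y' [0..<m] = map y [0..<m] \<and> map w' [0..<m] = map w [0..<m]"
          using w[of "Suc n"] by metis
      qed
      then have "(x, y) \<in> fst ` D" by force
      then show False using xy D(2) by blast
    qed
  next
    assume wf: "wf (E x y)"
    show "(x, y) \<in> C"
    proof (rule ccontr)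
      assume "(x, y) \<notin> C"
      then have "(x, y) \<in> fst ` D" using D(2) by blast
      then obtain w where w: "((x, y), w) \<in> D" by force
      have "\<forall>i. (map w [0..<Suc i], map w [0..<i]) \<in> E x y"
      proof
        fix i
        have "T (map x [0..<Suc i]) (map y [0..<Suc i]) (map w [0..<Suc i])"
          unfolding T_def using w by (intro exI[of _ x] exI[of _ y] exI[of _ w]) simp
        then show "(map w [0..<Suc i], map w [0..<i]) \<in> E x y" by (simp add: E_def)
      qed
      then have "\<exists>s. \<forall>i. (s (Suc i), s i) \<in> E x y" by (rule exI[of _ "\<lambda>i. map w [0..<i]"])
      then show False using wf unfolding wf_iff_no_infinite_down_chain by blast
    qed
  qed
  \<comment> \<open>Entry \<open>i\<close> of \<open>c\<close> carries the rank of the node with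
    code \<open>i\<close>. Only pairs whose codes and lengths fit into \<open>c\<close> are tested,
    so a finite segment suffices for the test, and every pair is tested at some stage.\<close>
  define R where "R u c \<longleftrightarrow> (\<forall>i<length c. \<forall>j<length c. \<forall>a. let t = from_nat i; t' = t @ [a] in
    from_nat j = t' \<longrightarrow> length t' \<le> length c \<longrightarrow> T (take (length t') u) (take (length t') (map fst c)) t' \<longrightarrow>
    (snd (c ! j), snd (c ! i)) \<in> ?r - Id)" for u :: "'a list" and c :: "(nat \<times> nat set) list"
  define K where "K = (UNIV :: nat set) \<times> Field ?r"
  have "x \<in> A \<longleftrightarrow> (\<exists>f. (\<forall>n. f n \<in> K) \<and> (\<forall>n. R (map x [0..<n]) (map f [0..<n])))" for x
  proof
    assume "x \<in> A"
    then obtain y where "(x, y) \<in> C" using C(2) by force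
    then obtain h where h: "range h \<subseteq> Field ?r" "\<And>t a. (t @ [a], t) \<in> E x y \<Longrightarrow> (h (t @ [a]), h t) \<in> ?r - Id"
      using wf_E[of x y] unfolding wf_iff_ex_aleph1_rank by blast
    define f where "f n = (y n, h (from_nat n))" for n
    have "R (map x [0..<n]) (map f [0..<n])" for n
      unfolding R_def Let_def
    proof (intro allI impI)
      fix i j a
      assume i: "i < length (map f [0..<n])" "j < length (map f [0..<n])"
        and j: "from_nat j = from_nat i @ [a]"
        and len: "length (from_nat i @ [a]) \<le> length (map f [0..<n])"
        and T: "T (take (length (from_nat i @ [a])) (map x [0..<n]))
          (take (length (from_nat i @ [a])) (map fst (map f [0..<n]))) (from_nat i @ [a])"
      have "(from_nat i @ [a], from_nat i) \<in> E x y"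
        using T len by (simp add: E_def take_map f_def comp_def)
      then show "(snd (map f [0..<n] ! j), snd (map f [0..<n] ! i)) \<in> ?r - Id"
        using h(2) i j by (simp add: f_def)
    qed
    moreover have "f n \<in> K" for n using h(1) by (auto simp: f_def K_def)
    ultimately show "\<exists>f. (\<forall>n. f n \<in> K) \<and> (\<forall>n. R (map x [0..<n]) (map f [0..<n]))" by blast
  next
    assume "\<exists>f. (\<forall>n. f n \<in> K) \<and> (\<forall>n. R (map x [0..<n]) (map f [0..<n]))"
    then obtain f where f: "\<And>n. f n \<in> K" and R: "\<And>n. R (map x [0..<n]) (map f [0..<n])" by blast
    define y where "y = fst \<circ> f"
    define h where "h t = snd (f (to_nat t))" for t :: "nat list"
    have "(h (t @ [a]), h t) \<in> ?r - Id" if E: "(t @ [a], t) \<in> E x y" for t a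
    proof -
      \<comment> \<open>A stage late enough for both codes to be below \<open>n\<close> and for the
        child to have length at most \<open>n\<close>.\<close>
      define n where "n = Suc (max (length t) (max (to_nat t) (to_nat (t @ [a]))))"
      have n: "to_nat t < n" "to_nat (t @ [a]) < n" "Suc (length t) \<le> n" by (auto simp: n_def)
      have "T (take (length (t @ [a])) (map x [0..<n])) (take (length (t @ [a])) (map fst (map f [0..<n]))) (t @ [a])"
        using E n(3) by (simp add: E_def take_map y_def comp_def)
      then have "(snd (map f [0..<n] ! to_nat (t @ [a])), snd (map f [0..<n] ! to_nat t)) \<in> ?r - Id"
        using R[of n, unfolded R_def Let_def, rule_format, of "to_nat t" "to_nat (t @ [a])" a] n by simp
      then show ?thesis using n by (simp add: h_def)
    qed
    moreover have "h t \<in> Field ?r" for t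
      using f[of "to_nat t"] by (auto simp: h_def K_def)
    then have "range h \<subseteq> Field ?r" by blast
    ultimately have "wf (E x y)"
      unfolding wf_iff_ex_aleph1_rank by (intro exI[of _ h]) (auto simp: E_def)
    then show "x \<in> A" using wf_E C(2) by force
  qed
  moreover have "|K| \<le>o cardSuc natLeq"
    unfolding K_def
    by (intro card_of_Times_le_aleph1 card_of_le_aleph1_if_countable ordIso_imp_ordLeq
        card_of_Field_ordIso Card_order_aleph1) simp
  ultimately show thesis by (intro that[of K R]) blast+
qed

section \<open>The abstract game\<close>

text \<open>A strategy of II for a game that ends after finitely many moves, though with no fixed
  bound: the subspace played by I determines II's vector and the rest of the strategy.\<close>

datatype 'a strategy_tree = Stop | Move "'a set \<Rightarrow> 'a \<times> 'a strategy_tree"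

text \<open>The properties of block subspaces that the game argument uses: countably many vectors,
  tails beyond every number, and pseudo-intersections of chains of size at most
  \<open>\<aleph>\<^sub>1\<close>. \<open>far n x\<close> stands for \<open>n < x\<close>.\<close>

locale asymptotic_game =
  fixes \<B> :: "'a set set" and far :: "nat \<Rightarrow> 'a \<Rightarrow> bool"
  assumes MA: "martins_axiom_aleph1 TYPE(nat set)"
    and countable_moves: "countable (UNIV :: 'a set)"
    and far_antimono: "m \<le> n \<Longrightarrow> far n x \<Longrightarrow> far m x"
    and ex_tail: "Y \<in> \<B> \<Longrightarrow> \<exists>Z\<in>\<B>. Z \<subseteq> {y \<in> Y. far n y}"
    and ex_pseudo_intersection:
      "C \<subseteq> \<B> \<Longrightarrow> C \<noteq> {} \<Longrightarrow> |C| \<le>o cardSuc natLeq \<Longrightarrow>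
       (\<And>X Y. X \<in> C \<Longrightarrow> Y \<in> C \<Longrightarrow>
          (\<exists>n. \<forall>y\<in>X. far n y \<longrightarrow> y \<in> Y) \<or> (\<exists>n. \<forall>y\<in>Y. far n y \<longrightarrow> y \<in> X)) \<Longrightarrow>
       \<exists>Z\<in>\<B>. \<forall>X\<in>C. \<exists>n. \<forall>y\<in>Z. far n y \<longrightarrow> y \<in> X"
begin

lemma countable_move_lists: "countable (UNIV :: 'a list set)"
  using countable_lists[OF countable_moves] by simp

section \<open>Almost containment and deciding subspaces\<close>

definition almost_subset :: "'a set \<Rightarrow> 'a set \<Rightarrow> bool" (infix \<open>\<subseteq>\<^sup>*\<close> 50) where
  "Y \<subseteq>\<^sup>* X \<longleftrightarrow> (\<exists>n. \<forall>y\<in>Y. far n y \<longrightarrow> y \<in> X)"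

lemma almost_subset_if_subset: "Y \<subseteq> X \<Longrightarrow> Y \<subseteq>\<^sup>* X"
  unfolding almost_subset_def by blast

lemma almost_subset_trans:
  assumes "Z \<subseteq>\<^sup>* Y" "Y \<subseteq>\<^sup>* X"
  shows "Z \<subseteq>\<^sup>* X"
proof -
  obtain m n where "\<forall>z\<in>Z. far m z \<longrightarrow> z \<in> Y" "\<forall>y\<in>Y. far n y \<longrightarrow> y \<in> X"
    using assms unfolding almost_subset_def by blast
  then show ?thesis
    unfolding almost_subset_def
    using far_antimono[of m "max m n"] far_antimono[of n "max m n"] by (intro exI[of _ "max m n"]) auto
qed

lemma ex_subset_if_almost_subset:
  assumes "Y \<in> \<B>" "Y \<subseteq>\<^sup>* X"
  obtains Z where "Z \<in> \<B>" "Z \<subseteq> Y" "Z \<subseteq> X"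
proof -
  obtain n where "\<forall>y\<in>Y. far n y \<longrightarrow> y \<in> X" using assms(2) unfolding almost_subset_def by blast
  moreover obtain Z where "Z \<in> \<B>" "Z \<subseteq> {y \<in> Y. far n y}" using ex_tail[OF assms(1)] by blast
  ultimately show thesis using that by blast
qed

text \<open>Iterate along a well-order of \<open>I\<close>; pseudo-intersections carry the construction through
  the limit steps.\<close>

lemma ex_deciding:
  assumes V: "V \<in> \<B>" and I: "|I| \<le>o cardSuc natLeq"
    and mono: "\<And>i X Y. i \<in> I \<Longrightarrow> X \<in> \<B> \<Longrightarrow> Y \<in> \<B> \<Longrightarrow> Y \<subseteq>\<^sup>* X \<Longrightarrow> P i X \<Longrightarrow> P i Y"
  obtains W where "W \<in> \<B>" "W \<subseteq> V"
    "\<And>i. i \<in> I \<Longrightarrow> P i W \<or> (\<forall>Y\<in>\<B>. Y \<subseteq>\<^sup>* W \<longrightarrow> \<not> P i Y)"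
proof -
  define R where "R = |I| - Id"
  define decides where "decides i X \<longleftrightarrow> P i X \<or> (\<forall>Y\<in>\<B>. Y \<subseteq>\<^sup>* X \<longrightarrow> \<not> P i Y)" for i X
  have wo: "Well_order |I|" by (rule card_of_Well_order)
  then have wf: "wf R" by (simp add: R_def well_order_on_def)
  have total: "total_on I |I|"
    using wo by (simp add: well_order_on_def linear_order_on_def partial_order_on_def preorder_on_def Field_card_of)
  have R_I: "(j, i) \<in> R \<Longrightarrow> j \<in> I \<and> i \<in> I" for i j
    using FieldI1[of j i "|I|"] FieldI2[of j i "|I|"] by (auto simp: R_def Field_card_of)
  have R_total: "i \<in> I \<Longrightarrow> j \<in> I \<Longrightarrow> i \<noteq> j \<Longrightarrow> (i, j) \<in> R \<or> (j, i) \<in> R" for i j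
    using total by (auto simp: R_def total_on_def)
  \<comment> \<open>The inductive requirement at \<open>i\<close>: below \<open>V\<close> and all
    earlier choices modulo finite, and deciding \<open>P i\<close>. Indices outside \<open>I\<close>
    are left free so that the recursion is total.\<close>
  define Q where "Q f i X \<longleftrightarrow> (i \<in> I \<longrightarrow> X \<in> \<B> \<and> X \<subseteq>\<^sup>* V \<and> (\<forall>j. (j, i) \<in> R \<longrightarrow> X \<subseteq>\<^sup>* f j) \<and> decides i X)"
    for f i X
  have pseudo: "\<exists>Z\<in>\<B>. Z \<subseteq>\<^sup>* V \<and> (\<forall>j\<in>J. Z \<subseteq>\<^sup>* f j)"
    if J: "J \<subseteq> I" and f: "\<And>j. j \<in> J \<Longrightarrow> Q f j (f j)" for J f
  proof -
    let ?C = "insert V (f ` J)"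
    have C: "?C \<subseteq> \<B>" using V f J by (auto simp: Q_def)
    have "|J| \<le>o cardSuc natLeq" by (rule ordLeq_transitive[OF card_of_mono1[OF J] I])
    then have "|{V} \<union> f ` J| \<le>o cardSuc natLeq"
      by (intro card_of_Un_le_aleph1 card_of_image_le_aleph1 card_of_le_aleph1_if_countable[of "{V}"]) simp
    then have "|?C| \<le>o cardSuc natLeq" by simp
    \<comment> \<open>The choices form a chain because of any two indices one precedes the other in
      the well-order.\<close>
    moreover have "f j \<subseteq>\<^sup>* f j' \<or> f j' \<subseteq>\<^sup>* f j" if "j \<in> J" "j' \<in> J" for j j'
    proof (cases "j = j'")
      case False
      then show ?thesis using R_total[of j j'] that J f[OF that(1)] f[OF that(2)]
        by (auto simp: Q_def)
    qed (simp add: almost_subset_if_subset)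
    then have "X \<subseteq>\<^sup>* Y \<or> Y \<subseteq>\<^sup>* X" if "X \<in> ?C" "Y \<in> ?C" for X Y
      using that f J by (auto simp: Q_def almost_subset_if_subset)
    ultimately have "\<exists>Z\<in>\<B>. \<forall>X\<in>?C. \<exists>n. \<forall>y\<in>Z. far n y \<longrightarrow> y \<in> X"
      using C by (intro ex_pseudo_intersection) (auto simp: almost_subset_def)
    then show ?thesis by (auto simp: almost_subset_def)
  qed
  have "\<exists>f. \<forall>i. Q f i (f i)"
  proof (rule dependent_wf_choice[OF wf])
    fix f g :: "'b \<Rightarrow> 'a set" and i X
    assume "\<And>j. (j, i) \<in> R \<Longrightarrow> f j = g j"
    then show "Q f i X = Q g i X" by (auto simp: Q_def)
  next
    fix i f assume f: "\<And>j. (j, i) \<in> R \<Longrightarrow> Q f j (f j)"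
    show "\<exists>X. Q f i X"
    proof (cases "i \<in> I")
      case True
      have "\<exists>Z\<in>\<B>. Z \<subseteq>\<^sup>* V \<and> (\<forall>j\<in>{j. (j, i) \<in> R}. Z \<subseteq>\<^sup>* f j)"
        by (rule pseudo) (use f R_I in auto)
      then obtain Z where Z: "Z \<in> \<B>" "Z \<subseteq>\<^sup>* V" "\<And>j. (j, i) \<in> R \<Longrightarrow> Z \<subseteq>\<^sup>* f j" by blast
      \<comment> \<open>Either some \<open>Y\<close> almost contained in \<open>Z\<close> has the
        property, and then \<open>Y\<close> decides, or \<open>Z\<close> itself decides
        negatively.\<close>
      have "\<exists>Y\<in>\<B>. Y \<subseteq>\<^sup>* Z \<and> decides i Y"
        using Z(1) almost_subset_if_subset[of Z Z] unfolding decides_def by blast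
      then show ?thesis using Z almost_subset_trans unfolding Q_def by blast
    qed (simp add: Q_def)
  qed
  then obtain f where f: "\<And>i. Q f i (f i)" by blast
  obtain Z where Z: "Z \<in> \<B>" "Z \<subseteq>\<^sup>* V" "\<And>j. j \<in> I \<Longrightarrow> Z \<subseteq>\<^sup>* f j"
    using pseudo[of I f] f by blast
  \<comment> \<open>A tail turns almost containment in \<open>V\<close> into containment.\<close>
  obtain W where W: "W \<in> \<B>" "W \<subseteq> Z" "W \<subseteq> V"
    using ex_subset_if_almost_subset[OF Z(1,2)] .
  show thesis
  proof (rule that[OF W(1,3)])
    fix i assume i: "i \<in> I"
    have "W \<subseteq>\<^sup>* f i"
      using almost_subset_trans[OF almost_subset_if_subset[OF W(2)] Z(3)[OF i]] .
    moreover have "decides i (f i)" "f i \<in> \<B>" using f[of i] i by (auto simp: Q_def)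
    ultimately show "P i W \<or> (\<forall>Y\<in>\<B>. Y \<subseteq>\<^sup>* W \<longrightarrow> \<not> P i Y)"
      unfolding decides_def using mono[OF i _ W(1)] almost_subset_trans by blast
  qed
qed

text \<open>I keeps the run outside of \<open>A\<close>; \<open>g\<close> maps positions to his moves. The moves of II need not
  be blocks here, since I can enforce this by playing large numbers.\<close>

definition avoidable :: "'a set \<Rightarrow> 'a list \<Rightarrow> (nat \<Rightarrow> 'a) set \<Rightarrow> bool" where
  "avoidable W p A \<longleftrightarrow> (\<exists>g :: 'a list \<Rightarrow> nat. \<forall>x. map x [0..<length p] = p \<longrightarrow>
     (\<forall>i\<ge>length p. x i \<in> W \<and> far (g (map x [0..<i])) (x i)) \<longrightarrow> x \<notin> A)"

text \<open>I raises all his moves to at least \<open>n\<close>, which forces II's vectors from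
  \<open>Y\<close> into \<open>X\<close>.\<close>

lemma avoidable_almost_subset:
  assumes "avoidable X p A" "Y \<subseteq>\<^sup>* X"
  shows "avoidable Y p A"
proof -
  obtain g where g: "\<And>x. map x [0..<length p] = p \<Longrightarrow>
     (\<forall>i\<ge>length p. x i \<in> X \<and> far (g (map x [0..<i])) (x i)) \<Longrightarrow> x \<notin> A"
    using assms(1) unfolding avoidable_def by blast
  obtain n where n: "\<And>y. y \<in> Y \<Longrightarrow> far n y \<Longrightarrow> y \<in> X"
    using assms(2) unfolding almost_subset_def by blast
  show ?thesis
    unfolding avoidable_def
  proof (intro exI[of _ "\<lambda>q. max n (g q)"] allI impI)
    fix x assume x: "map x [0..<length p] = p"
      "\<forall>i\<ge>length p. x i \<in> Y \<and> far (max n (g (map x [0..<i]))) (x i)"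
    show "x \<notin> A"
      by (rule g) (use x n far_antimono[OF max.cobounded1] far_antimono[OF max.cobounded2] in blast)+
  qed
qed

section \<open>Reaching a target in finitely many moves\<close>

text \<open>The positions from which II can force the run into \<open>T\<close> against subspaces of
  \<open>X\<close>, as a least fixed point: the game is open for II, so its winning positions carry
  an induction.\<close>

inductive reach :: "'a set \<Rightarrow> 'a list set \<Rightarrow> 'a list \<Rightarrow> bool" for X T where
  target: "q \<in> T \<Longrightarrow> reach X T q"
| move: "(\<And>Y. Y \<in> \<B> \<Longrightarrow> Y \<subseteq> X \<Longrightarrow> \<exists>y\<in>Y. reach X T (q @ [y])) \<Longrightarrow> reach X T q"

text \<open>At least one move is required first, even if \<open>q\<close> is in \<open>T\<close>.
  This keeps nodes no longer than positions when II later passes from node to node.\<close>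

definition reach_later :: "'a set \<Rightarrow> 'a list set \<Rightarrow> 'a list \<Rightarrow> bool" where
  "reach_later X T q \<longleftrightarrow> (\<forall>Y\<in>\<B>. Y \<subseteq> X \<longrightarrow> (\<exists>y\<in>Y. reach X T (q @ [y])))"

lemma reach_if_reach_later: "reach_later X T q \<Longrightarrow> reach X T q"
  unfolding reach_later_def by (rule reach.move) blast

text \<open>A subspace of \<open>Y\<close> shrinks to one inside \<open>X\<close>, and II's answer
  to the smaller subspace is legal for the larger one.\<close>

lemma reach_almost_subset:
  assumes "reach X T q" "Y \<subseteq>\<^sup>* X"
  shows "reach Y T q"
  using assms(1)
proof induction
  case (move q)
  show ?case
  proof (rule reach.move)
    fix Z assume "Z \<in> \<B>" "Z \<subseteq> Y"
    moreover then have "Z \<subseteq>\<^sup>* X" using almost_subset_trans[OF almost_subset_if_subset assms(2)] by blast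
    ultimately obtain Z' where "Z' \<in> \<B>" "Z' \<subseteq> Z" "Z' \<subseteq> X" by (metis ex_subset_if_almost_subset)
    then show "\<exists>y\<in>Z. reach Y T (q @ [y])" using move by blast
  qed
qed (rule reach.target)

text \<open>The tree leads II from \<open>q\<close> into \<open>T\<close> against every play of I,
  each move being beyond the number that \<open>N\<close> assigns to the position. Being inductive,
  it excludes runs that never reach \<open>Stop\<close>.\<close>

inductive follows :: "('a list \<Rightarrow> nat) \<Rightarrow> 'a set \<Rightarrow> 'a list set \<Rightarrow> 'a strategy_tree \<Rightarrow> 'a list \<Rightarrow> bool"
  for N X T where
  Stop: "q \<in> T \<Longrightarrow> follows N X T Stop q"
| Move: "(\<And>Y. Y \<in> \<B> \<Longrightarrow> Y \<subseteq> X \<Longrightarrow> fst (m Y) \<in> Y \<and> far (N q) (fst (m Y)) \<and>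
    follows N X T (snd (m Y)) (q @ [fst (m Y)])) \<Longrightarrow> follows N X T (Move m) q"

text \<open>The bound \<open>N q\<close> costs nothing: II first replaces \<open>Y\<close> by a tail
  beyond \<open>N q\<close> and answers that.\<close>

lemma follows_Move_if_later:
  assumes "\<And>Y. Y \<in> \<B> \<Longrightarrow> Y \<subseteq> X \<Longrightarrow> \<exists>y\<in>Y. \<exists>t. follows N X T t (q @ [y])"
  shows "\<exists>m. follows N X T (Move m) q"
proof -
  have "\<exists>yt. Y \<in> \<B> \<longrightarrow> Y \<subseteq> X \<longrightarrow>
    fst yt \<in> Y \<and> far (N q) (fst yt) \<and> follows N X T (snd yt) (q @ [fst yt])" for Y
  proof (cases "Y \<in> \<B> \<and> Y \<subseteq> X")
    case True
    then obtain Z where "Z \<in> \<B>" "Z \<subseteq> {y \<in> Y. far (N q) y}" using ex_tail by blast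
    then obtain y t where "y \<in> Z" "follows N X T t (q @ [y])" using assms[of Z] True by blast
    then show ?thesis using \<open>Z \<subseteq> _\<close> by (intro exI[of _ "(y, t)"]) auto
  qed auto
  then have "\<exists>m. \<forall>Y. Y \<in> \<B> \<longrightarrow> Y \<subseteq> X \<longrightarrow>
    fst (m Y) \<in> Y \<and> far (N q) (fst (m Y)) \<and> follows N X T (snd (m Y)) (q @ [fst (m Y)])"
    by (intro choice) blast
  then obtain m where "\<And>Y. Y \<in> \<B> \<Longrightarrow> Y \<subseteq> X \<Longrightarrow>
    fst (m Y) \<in> Y \<and> far (N q) (fst (m Y)) \<and> follows N X T (snd (m Y)) (q @ [fst (m Y)])"
    by blast
  then have "follows N X T (Move m) q" by (rule follows.Move)
  then show ?thesis by blast
qed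

lemma ex_follows_if_reach: "reach X T q \<Longrightarrow> \<exists>t. follows N X T t q"
proof (induction rule: reach.induct)
  case (target q)
  then show ?case by (blast intro: follows.Stop)
next
  case (move q)
  then show ?case using follows_Move_if_later[of X N T q] by blast
qed

lemma ex_follows_if_reach_later: "reach_later X T q \<Longrightarrow> \<exists>m. follows N X T (Move m) q"
  unfolding reach_later_def by (rule follows_Move_if_later) (blast dest: ex_follows_if_reach)

text \<open>\<open>X i q\<close> says that II cannot reach \<open>T i\<close> from \<open>q\<close> in a larger \<open>U \<in> \<B>\<close> that decides
  reachability from all positions. The last alternative comes from deciding, below \<open>U\<close>, whether
  almost all next moves are of this kind.\<close>

lemma ex_reach_dichotomy:
  assumes V: "V \<in> \<B>" and I: "|I| \<le>o cardSuc natLeq"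
  obtains W X where "W \<in> \<B>" "W \<subseteq> V"
    "\<And>i q. i \<in> I \<Longrightarrow> X i q \<Longrightarrow> q \<notin> T i"
    "\<And>i q. i \<in> I \<Longrightarrow> X i q \<Longrightarrow> \<exists>n. \<forall>x\<in>W. far n x \<longrightarrow> X i (q @ [x])"
    "\<And>i q. i \<in> I \<Longrightarrow> reach_later W (T i) q \<or> (\<exists>n. \<forall>x\<in>W. far n x \<longrightarrow> X i (q @ [x]))"
proof -
  let ?J = "I \<times> (UNIV :: 'a list set)"
  have J: "|?J| \<le>o cardSuc natLeq"
    using I card_of_le_aleph1_if_countable[OF countable_move_lists] by (rule card_of_Times_le_aleph1)
  obtain U where U: "U \<in> \<B>" "U \<subseteq> V"
    and U_decides: "\<And>j. j \<in> ?J \<Longrightarrow> (case j of (i, q) \<Rightarrow> \<lambda>Y. reach Y (T i) q) U \<or>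
      (\<forall>Y\<in>\<B>. Y \<subseteq>\<^sup>* U \<longrightarrow> \<not> (case j of (i, q) \<Rightarrow> \<lambda>Y. reach Y (T i) q) Y)"
    by (rule ex_deciding[OF V J, where P = "\<lambda>(i, q) Y. reach Y (T i) q"])
      (auto intro: reach_almost_subset)
  define M where "M = (\<lambda>(i, q) Y. \<exists>n. \<forall>x\<in>Y. far n x \<longrightarrow> \<not> reach U (T i) (q @ [x]))"
  have M_mono: "M j Y" if M: "M j X" and YX: "Y \<subseteq>\<^sup>* X" for j X Y
  proof -
    obtain i q where j: "j = (i, q)" by force
    obtain m where m: "\<forall>x\<in>X. far m x \<longrightarrow> \<not> reach U (T i) (q @ [x])" using M by (auto simp: M_def j)
    obtain n where n: "\<forall>y\<in>Y. far n y \<longrightarrow> y \<in> X" using YX unfolding almost_subset_def by blast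
    have "\<forall>x\<in>Y. far (max m n) x \<longrightarrow> \<not> reach U (T i) (q @ [x])"
      using m n far_antimono[OF max.cobounded1] far_antimono[OF max.cobounded2] by blast
    then show ?thesis by (auto simp: M_def j)
  qed
  obtain W where W: "W \<in> \<B>" "W \<subseteq> U"
    and W_decides: "\<And>j. j \<in> ?J \<Longrightarrow> M j W \<or> (\<forall>Y\<in>\<B>. Y \<subseteq>\<^sup>* W \<longrightarrow> \<not> M j Y)"
    by (rule ex_deciding[OF U(1) J, where P = M]) (blast intro: M_mono)+
  have later: "reach_later W (T i) q \<or> (\<exists>n. \<forall>x\<in>W. far n x \<longrightarrow> \<not> reach U (T i) (q @ [x]))"
    if i: "i \<in> I" for i q
  proof (cases "M (i, q) W")
    case False
    have "\<exists>y\<in>Y. reach W (T i) (q @ [y])" if Y: "Y \<in> \<B>" "Y \<subseteq> W" for Y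
    proof -
      \<comment> \<open>The negative decision of \<open>W\<close> passes to every smaller
        \<open>Y\<close>, so in each of them II finds a next vector from which the target is
        reachable.\<close>
      have "\<not> M (i, q) Y" using W_decides[of "(i, q)"] False i Y almost_subset_if_subset by blast
      then obtain y where "y \<in> Y" "reach U (T i) (q @ [y])" by (auto simp: M_def)
      then show ?thesis using reach_almost_subset almost_subset_if_subset[OF W(2)] by blast
    qed
    then show ?thesis unfolding reach_later_def by blast
  qed (auto simp: M_def)
  show thesis
  proof (rule that[of W "\<lambda>i q. \<not> reach U (T i) q"])
    show "W \<in> \<B>" "W \<subseteq> V" using W U by auto
    show "q \<notin> T i" if "\<not> reach U (T i) q" for i q using that reach.target by blast
    show "\<exists>n. \<forall>x\<in>W. far n x \<longrightarrow> \<not> reach U (T i) (q @ [x])"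
      if i: "i \<in> I" and q: "\<not> reach U (T i) q" for i q
    proof -
      \<comment> \<open>As \<open>U\<close> decides reachability, its failure persists in
        \<open>W\<close>, which leaves only the second alternative of \<open>later\<close>.\<close>
      have "\<not> reach W (T i) q"
        using U_decides[of "(i, q)"] i q W almost_subset_if_subset[OF W(2)] by auto
      then have "\<not> reach_later W (T i) q" using reach_if_reach_later by blast
      then show ?thesis using later[OF i] by blast
    qed
  qed (use later in blast)
qed

text \<open>I plays large enough to enter \<open>X\<close> and stay there, and at least a function
  \<open>g\<close> that dominates, modulo finitely many positions, his strategies for every
  \<open>B \<xi>\<close>. Once the exceptional positions for \<open>\<xi>\<close> are passed, the
  rest of the run obeys the strategy against \<open>B \<xi>\<close> from a position in
  \<open>X\<close>.\<close>

lemma avoidable_UN: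
  assumes K: "|K| \<le>o cardSuc natLeq"
    and start: "\<exists>n. \<forall>x\<in>W. far n x \<longrightarrow> X (p @ [x])"
    and step: "\<And>q. X q \<Longrightarrow> \<exists>n. \<forall>x\<in>W. far n x \<longrightarrow> X (q @ [x])"
    and avoidable: "\<And>q \<xi>. X q \<Longrightarrow> \<xi> \<in> K \<Longrightarrow> avoidable W q (B \<xi>)"
  shows "avoidable W p (\<Union>\<xi>\<in>K. B \<xi>)"
proof -
  \<comment> \<open>The initial position \<open>p\<close> is a separate case, since it need not
    satisfy \<open>X\<close>.\<close>
  have "\<exists>n. X q \<or> q = p \<longrightarrow> (\<forall>x\<in>W. far n x \<longrightarrow> X (q @ [x]))" for q using start step by blast
  then obtain n where n: "\<And>q x. X q \<or> q = p \<Longrightarrow> x \<in> W \<Longrightarrow> far (n q) x \<Longrightarrow> X (q @ [x])" by metis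
  define avoids where "avoids \<xi> q h \<longleftrightarrow> (\<forall>x. map x [0..<length q] = q \<longrightarrow>
     (\<forall>i\<ge>length q. x i \<in> W \<and> far (h (map x [0..<i])) (x i)) \<longrightarrow> x \<notin> B \<xi>)"
    for \<xi> q and h :: "'a list \<Rightarrow> nat"
  have h_ex: "\<exists>h. X q \<longrightarrow> \<xi> \<in> K \<longrightarrow> avoids \<xi> q h" for \<xi> q
    using avoidable unfolding avoidable_def avoids_def by blast
  define h where "h \<xi> q = (SOME h. X q \<longrightarrow> \<xi> \<in> K \<longrightarrow> avoids \<xi> q h)" for \<xi> q
  have "avoids \<xi> q (h \<xi> q)" if "X q" "\<xi> \<in> K" for \<xi> q
    using someI_ex[OF h_ex[of q \<xi>]] that unfolding h_def by blast
  then have h: "x \<notin> B \<xi>" if "X q" "\<xi> \<in> K" "map x [0..<length q] = q"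
    "\<And>i. length q \<le> i \<Longrightarrow> x i \<in> W \<and> far (h \<xi> q (map x [0..<i])) (x i)" for \<xi> q x
    using that unfolding avoids_def by blast
  \<comment> \<open>Where the exceptions end is not known in advance, so this bounds the strategies
    started at every prefix of \<open>q\<close>; it also makes one function per
    \<open>\<xi>\<close>.\<close>
  define H where "H \<xi> q = (\<Sum>j\<le>length q. h \<xi> (take j q) q)" for \<xi> q
  obtain g where g: "\<And>f. f \<in> H ` K \<Longrightarrow> finite {q. g q < f q}"
    using ex_dominating_function[OF MA countable_move_lists card_of_image_le_aleph1[OF K]] by blast
  show ?thesis
    unfolding avoidable_def
  proof (intro exI[of _ "\<lambda>q. max (g q) (n q)"] allI impI notI)
    fix x assume p: "map x [0..<length p] = p"
      and x: "\<forall>i\<ge>length p. x i \<in> W \<and> far (max (g (map x [0..<i])) (n (map x [0..<i]))) (x i)"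
      and "x \<in> (\<Union>\<xi>\<in>K. B \<xi>)"
    then obtain \<xi> where \<xi>: "\<xi> \<in> K" "x \<in> B \<xi>" by blast
    have far: "far (g (map x [0..<i])) (x i)" "far (n (map x [0..<i])) (x i)" if "length p \<le> i" for i
      using x that far_antimono[OF max.cobounded1] far_antimono[OF max.cobounded2] by blast+
    have X: "X (map x [0..<i])" if "Suc (length p) \<le> i" for i
      using that
    proof (induction i rule: dec_induct)
      case base
      then show ?case using n[of p "x (length p)"] p x far(2)[of "length p"] by simp
    next
      case (step i)
      then show ?case using n[of "map x [0..<i]" "x i"] x far(2)[of i] by simp
    qed
    obtain k where k: "\<And>q. q \<in> {q. g q < H \<xi> q} \<Longrightarrow> length q < k"
      using g[of "H \<xi>"] \<xi>(1) finite_nat_set_iff_bounded[of "length ` {q. g q < H \<xi> q}"] by auto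
    \<comment> \<open>Late enough to be past all exceptions and past the first move, from which
      point on \<open>X\<close> holds.\<close>
    define l where "l = max k (Suc (length p))"
    have "x \<notin> B \<xi>"
    proof (rule h[OF X \<xi>(1)])
      show "Suc (length p) \<le> l" by (simp add: l_def)
      show "map x [0..<length (map x [0..<l])] = map x [0..<l]" by simp
    next
      fix i assume "length (map x [0..<l]) \<le> i"
      then have i: "k \<le> i" "length p \<le> i" "l \<le> i" by (auto simp: l_def)
      have "h \<xi> (take l (map x [0..<i])) (map x [0..<i]) \<le> H \<xi> (map x [0..<i])"
        unfolding H_def using i(3)
        by (intro member_le_sum[where f = "\<lambda>j. h \<xi> (take j (map x [0..<i])) (map x [0..<i])"]) auto
      moreover have "H \<xi> (map x [0..<i]) \<le> g (map x [0..<i])"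
        using k[of "map x [0..<i]"] i(1) by fastforce
      ultimately have "h \<xi> (map x [0..<l]) (map x [0..<i]) \<le> g (map x [0..<i])"
        using i(3) by (simp add: take_map min_def)
      then show "x i \<in> W \<and> far (h \<xi> (map x [0..<l]) (map x [0..<i])) (x i)"
        using x i(2) far(1) far_antimono by blast
    qed
    then show False using \<xi>(2) by blast
  qed
qed

section \<open>The strategy of II and the abstract dichotomy\<close>

text \<open>\<open>N\<close> is applied to the whole position, \<open>z\<close> included; a suitable
  choice will make the vectors of II successive blocks.\<close>

definition II_wins :: "('a list \<Rightarrow> nat) \<Rightarrow> 'a set \<Rightarrow> 'a list \<Rightarrow> (nat \<Rightarrow> 'a) set \<Rightarrow> bool" where
  "II_wins N W z A \<longleftrightarrow> (\<exists>\<sigma> :: 'a set list \<Rightarrow> 'a. \<forall>Y x.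
     (\<forall>i. Y i \<in> \<B> \<and> Y i \<subseteq> W) \<longrightarrow> (\<forall>i. x i = \<sigma> (map Y [0..<Suc i])) \<longrightarrow>
     (\<forall>i. x i \<in> Y i \<and> far (N (z @ map x [0..<i])) (x i)) \<and> z \<frown> x \<in> A)"

text \<open>A state consists of the position, the node of the tree on \<open>K\<close> that II has reached, and a
  strategy tree leading to a good child of this node.\<close>

lemma II_wins_if_reach_later:
  fixes R :: "'a list \<Rightarrow> 'k list \<Rightarrow> bool"
  assumes init: "good z []"
    and later: "\<And>q s. good q s \<Longrightarrow> reach_later W {q'. \<exists>\<xi>\<in>K. good q' (s @ [\<xi>])} q"
    and R: "\<And>q s n. good q s \<Longrightarrow> length s \<le> length q \<Longrightarrow> n \<le> length s \<Longrightarrow> R (take n q) (take n s)"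
  shows "II_wins N W z {x. \<exists>f. (\<forall>n. f n \<in> K) \<and> (\<forall>n. R (map x [0..<n]) (map f [0..<n]))}"
proof -
  define T where "T s = {q'. \<exists>\<xi>\<in>K. good q' (s @ [\<xi>])}" for s
  \<comment> \<open>The tree begins with \<open>Move\<close> because \<open>reach_later\<close> asks
    for a further move, so a state never stores \<open>Stop\<close>.\<close>
  define start where "start q s = (SOME m. follows N W (T s) (Move m) q)" for q s
  have start: "follows N W (T s) (Move (start q s)) q" if "good q s" for q s
    unfolding start_def
    by (rule someI_ex[of "\<lambda>m. follows N W (T s) (Move m) q"])
      (unfold T_def, rule ex_follows_if_reach_later[OF later[OF that]])
  define child where "child q s = s @ [SOME \<xi>. \<xi> \<in> K \<and> good q (s @ [\<xi>])]" for q s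
  have child: "\<exists>\<xi>\<in>K. child q s = s @ [\<xi>] \<and> good q (s @ [\<xi>])" if "q \<in> T s" for q s
    using someI_ex[of "\<lambda>\<xi>. \<xi> \<in> K \<and> good q (s @ [\<xi>])"] that by (auto simp: T_def child_def)
  \<comment> \<open>When the tree stops, the target is reached: II passes to a good child and starts
    the tree for that child at once.\<close>
  define step where "step = (\<lambda>(q, s, m) (Y :: 'a set). let q' = q @ [fst (m Y)] in
    case snd (m Y) of Move m' \<Rightarrow> (q', s, m') | Stop \<Rightarrow> (q', child q' s, start q' (child q' s)))"
  define run where "run Ys = foldl step (z, [], start z []) Ys" for Ys
  \<comment> \<open>Each new node costs at least one move, hence the bound on its length, which
    \<open>R\<close> needs.\<close>
  define inv where "inv = (\<lambda>(q, s, m). follows N W (T s) (Move m) q \<and> length s \<le> length q \<and>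
    set s \<subseteq> K \<and> (\<forall>n\<le>length s. R (take n q) (take n s)))"
  have inv_start: "inv (z, [], start z [])"
    using start[OF init] R[OF init, of 0] by (simp add: inv_def)
  have inv_step: "inv (step (q, s, m) Y)" if inv: "inv (q, s, m)" and Y: "Y \<in> \<B>" "Y \<subseteq> W" for q s m Y
  proof -
    let ?q = "q @ [fst (m Y)]"
    have follows: "follows N W (T s) (snd (m Y)) ?q"
      using inv Y by (auto simp: inv_def elim: follows.cases)
    show ?thesis
    proof (cases "snd (m Y)")
      case Stop
      then have "?q \<in> T s" using follows by (auto elim: follows.cases)
      then obtain \<xi> where \<xi>: "\<xi> \<in> K" "child ?q s = s @ [\<xi>]" "good ?q (s @ [\<xi>])" using child by blast
      have "step (q, s, m) Y = (?q, s @ [\<xi>], start ?q (s @ [\<xi>]))"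
        by (simp add: step_def Stop \<xi>(2) Let_def)
      moreover have "length (s @ [\<xi>]) \<le> length ?q" "set (s @ [\<xi>]) \<subseteq> K"
        using inv \<xi>(1) by (auto simp: inv_def)
      ultimately show ?thesis using start[OF \<xi>(3)] R[OF \<xi>(3)] by (simp only: inv_def prod.case) blast
    next
      case (Move m')
      then show ?thesis using inv follows by (simp add: step_def inv_def)
    qed
  qed
  show ?thesis
    unfolding II_wins_def
  proof (intro exI[of _ "\<lambda>Ys. last (fst (run Ys))"] allI impI)
    fix Y x assume Y: "\<forall>i. Y i \<in> \<B> \<and> Y i \<subseteq> W" and x: "\<forall>i. x i = last (fst (run (map Y [0..<Suc i])))"
    define S where "S i = run (map Y [0..<i])" for i
    define pos where "pos i = fst (S i)" for i
    define node where "node i = fst (snd (S i))" for i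
    have S: "S i = (pos i, node i, snd (snd (S i)))" for i by (simp add: pos_def node_def)
    have S_Suc: "S (Suc i) = step (S i) (Y i)" for i by (simp add: S_def run_def)
    have inv: "inv (S i)" for i
    proof (induction i)
      case 0 then show ?case using inv_start by (simp add: S_def run_def)
    next
      case (Suc i) then show ?case using inv_step S Y S_Suc by metis
    qed
    have state: "follows N W (T (node i)) (Move (snd (snd (S i)))) (pos i)"
      "length (node i) \<le> length (pos i)" "set (node i) \<subseteq> K"
      "n \<le> length (node i) \<Longrightarrow> R (take n (pos i)) (take n (node i))" for i n
      using inv[of i] by (cases "S i"; auto simp: inv_def pos_def node_def)+
    have pos_Suc': "pos (Suc i) = pos i @ [fst (snd (snd (S i)) (Y i))]" for i
      using S[of i] S_Suc[of i]
      by (auto simp: pos_def step_def Let_def split: strategy_tree.splits prod.splits)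
    moreover have x_i: "x i = last (pos (Suc i))" for i using x by (simp add: pos_def S_def)
    ultimately have x_move: "x i = fst (snd (snd (S i)) (Y i))" and pos_Suc: "pos (Suc i) = pos i @ [x i]" for i
      by simp_all
    have pos: "pos i = z @ map x [0..<i]" for i
      by (induction i) (simp_all add: pos_Suc, simp add: pos_def S_def run_def)
    have legal: "x i \<in> Y i \<and> far (N (z @ map x [0..<i])) (x i)" for i
      using state(1)[of i] Y by (auto elim: follows.cases simp: x_move pos)
    have node_Suc: "prefix (node i) (node (Suc i))" for i
      using S[of i] S_Suc[of i]
      by (auto simp: node_def step_def Let_def child_def split: strategy_tree.splits prod.splits)
    have node_mono: "prefix (node i) (node j)" if "i \<le> j" for i j
      using that by (induction j rule: dec_induct) (use node_Suc prefix_order.trans in blast)+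
    \<comment> \<open>Induction along the strategy tree: its well-foundedness forces a
      \<open>Stop\<close> during the run, and there the node grows.\<close>
    have progress: "\<forall>i m. t = Move m \<longrightarrow> S i = (q, s, m) \<longrightarrow> (\<exists>j. length s < length (node j))"
      if "follows N W (T s) t q" for t q s
      using that
    proof induction
      case (Move m q)
      show ?case
      proof (intro allI impI)
        fix i m' assume "Move m = Move m'" and Si: "S i = (q, s, m')"
        then have m: "m' = m" by simp
        show "\<exists>j. length s < length (node j)"
        proof (cases "snd (m (Y i))")
          case Stop
          then have "length s < length (node (Suc i))"
            using Si m by (simp add: node_def S_Suc step_def child_def Let_def)
          then show ?thesis by blast
        next
          case Move': (Move m'')
          then have "S (Suc i) = (q @ [fst (m (Y i))], s, m'')"
            using Si m by (simp add: S_Suc step_def Let_def)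
          then show ?thesis using Move[of "Y i"] Move' Y by blast
        qed
      qed
    qed simp
    have longer: "\<exists>j. length (node i) < length (node j)" for i
      using progress[OF state(1)] S[of i] by blast
    have "\<exists>i. n < length (node i)" for n
    proof (induction n)
      case 0 then show ?case using longer[of 0] by (metis gr0I gr_implies_not0)
    next
      case (Suc n) then show ?case using longer by (metis Suc_lessI less_trans_Suc)
    qed
    \<comment> \<open>\<open>I n\<close> is a stage at which the node has an entry at
      \<open>n\<close>; the branch \<open>f\<close> is read off there.\<close>
    then obtain I where I: "\<And>n. n < length (node (I n))" by metis
    define f where "f n = node (I n) ! n" for n
    have node_nth: "node i ! n = f n" if "n < length (node i)" for i n
      using node_mono[of i "I n"] node_mono[of "I n" i] that I[of n] nle_le
      unfolding f_def prefix_def by (metis nth_append)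
    have "f n \<in> K" for n
      using state(3)[of "I n"] nth_mem[OF I[of n]] unfolding f_def by blast
    moreover have "R (map (z \<frown> x) [0..<n]) (map f [0..<n])" for n
    proof -
      have "R (take n (pos (I n))) (take n (node (I n)))" and len: "length (node (I n)) \<le> length (pos (I n))"
        using state(2)[of "I n"] state(4)[of n "I n"] I[of n] by simp_all
      moreover have "take n (node (I n)) = map f [0..<n]"
        using I[of n] node_nth[of _ "I n"] by (intro nth_equalityI) auto
      moreover have "take n (pos (I n)) = map (z \<frown> x) [0..<n]"
        using I[of n] len by (intro nth_equalityI) (auto simp: pos nth_append conc_def)
      ultimately show ?thesis by simp
    qed
    ultimately show "(\<forall>i. x i \<in> Y i \<and> far (N (z @ map x [0..<i])) (x i)) \<and>
      z \<frown> x \<in> {x. \<exists>f. (\<forall>n. f n \<in> K) \<and> (\<forall>n. R (map x [0..<n]) (map f [0..<n]))}"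
      using legal by blast
  qed
qed

text \<open>\<open>U\<close> decides avoidability for all nodes and positions, \<open>W\<close>
  decides reachability of good children. II wins if the root is good at \<open>z\<close>; otherwise
  I already avoids \<open>A\<close> in \<open>U\<close>.\<close>

theorem souslin_dichotomy:
  fixes R :: "'a list \<Rightarrow> 'k list \<Rightarrow> bool"
  assumes V: "V \<in> \<B>" and K: "|K| \<le>o cardSuc natLeq"
  defines "A \<equiv> {x. \<exists>f. (\<forall>n. f n \<in> K) \<and> (\<forall>n. R (map x [0..<n]) (map f [0..<n]))}"
  obtains W where "W \<in> \<B>" "W \<subseteq> V" "avoidable W z A \<or> II_wins N W z A"
proof -
  \<comment> \<open>The points that have a branch through the node \<open>s\<close>.\<close>
  define A' where "A' s = {x. \<exists>f. (\<forall>n. f n \<in> K) \<and> map f [0..<length s] = s \<and>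
    (\<forall>n. R (map x [0..<n]) (map f [0..<n]))}" for s
  have A'_Nil: "A' [] = A" by (simp add: A'_def A_def)
  have A'_UN: "A' s \<subseteq> (\<Union>\<xi>\<in>K. A' (s @ [\<xi>]))" for s
  proof
    fix x assume "x \<in> A' s"
    then obtain f where "\<forall>n. f n \<in> K" "map f [0..<length s] = s"
      "\<forall>n. R (map x [0..<n]) (map f [0..<n])" by (auto simp: A'_def)
    then show "x \<in> (\<Union>\<xi>\<in>K. A' (s @ [\<xi>]))"
      by (intro UN_I[of "f (length s)"]) (auto simp: A'_def intro!: exI[of _ f])
  qed
  have lists: "|lists K| \<le>o cardSuc natLeq" by (rule card_of_lists_le_aleph1[OF K])
  have J: "|lists K \<times> (UNIV :: 'a list set)| \<le>o cardSuc natLeq"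
    by (rule card_of_Times_le_aleph1[OF lists card_of_le_aleph1_if_countable[OF countable_move_lists]])
  obtain U where U: "U \<in> \<B>" "U \<subseteq> V" and decides: "\<And>j. j \<in> lists K \<times> UNIV \<Longrightarrow>
      (case j of (s, q) \<Rightarrow> \<lambda>Y. avoidable Y q (A' s)) U \<or>
      (\<forall>Y\<in>\<B>. Y \<subseteq>\<^sup>* U \<longrightarrow> \<not> (case j of (s, q) \<Rightarrow> \<lambda>Y. avoidable Y q (A' s)) Y)"
    by (rule ex_deciding[OF V J, where P = "\<lambda>(s, q) Y. avoidable Y q (A' s)"])
      (auto intro: avoidable_almost_subset)
  define good where "good q s \<longleftrightarrow> s \<in> lists K \<and> \<not> avoidable U q (A' s)" for q s
  define T where "T s = {q. \<exists>\<xi>\<in>K. good q (s @ [\<xi>])}" for s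
  obtain W X where W: "W \<in> \<B>" "W \<subseteq> U"
    and X_T: "\<And>s q. s \<in> lists K \<Longrightarrow> X s q \<Longrightarrow> q \<notin> T s"
    and X_step: "\<And>s q. s \<in> lists K \<Longrightarrow> X s q \<Longrightarrow> \<exists>n. \<forall>x\<in>W. far n x \<longrightarrow> X s (q @ [x])"
    and later_or_X: "\<And>s q. s \<in> lists K \<Longrightarrow>
      reach_later W (T s) q \<or> (\<exists>n. \<forall>x\<in>W. far n x \<longrightarrow> X s (q @ [x]))"
    by (rule ex_reach_dichotomy[OF U(1) lists, where T = T]) (rule that)
  have WU: "W \<subseteq>\<^sup>* U" by (rule almost_subset_if_subset[OF W(2)])
  \<comment> \<open>Otherwise I can enter \<open>X s\<close> and stay there. No child of
    \<open>s\<close> is good at those positions, so I avoids every \<open>A' (s @ [\<xi>])\<close>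
    from them and, by \<open>avoidable_UN\<close>, avoids \<open>A' s\<close> from \<open>q\<close>
    in \<open>W\<close>, against the decision of \<open>U\<close>.\<close>
  have later: "reach_later W {q'. \<exists>\<xi>\<in>K. good q' (s @ [\<xi>])} q" if good: "good q s" for q s
  proof (rule ccontr)
    assume "\<not> ?thesis"
    moreover have s: "s \<in> lists K" using good by (simp add: good_def)
    ultimately have start: "\<exists>n. \<forall>x\<in>W. far n x \<longrightarrow> X s (q @ [x])"
      using later_or_X[OF s, of q] by (simp add: T_def)
    have "avoidable W q' (A' (s @ [\<xi>]))" if "X s q'" "\<xi> \<in> K" for q' \<xi>
    proof -
      have "\<not> good q' (s @ [\<xi>])" using X_T[OF s that(1)] that(2) by (auto simp: T_def)
      then have "avoidable U q' (A' (s @ [\<xi>]))" using s that(2) by (simp add: good_def)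
      then show ?thesis using WU by (rule avoidable_almost_subset)
    qed
    with K start X_step[OF s] have "avoidable W q (\<Union>\<xi>\<in>K. A' (s @ [\<xi>]))"
      by (rule avoidable_UN)
    then have "avoidable W q (A' s)" using A'_UN[of s] unfolding avoidable_def by blast
    moreover have "\<not> avoidable W q (A' s)"
      using decides[of "(s, q)"] good s WU W(1) by (auto simp: good_def)
    ultimately show False by blast
  qed
  \<comment> \<open>If no point of \<open>A' s\<close> extended \<open>q\<close>, any strategy of I
    would avoid \<open>A' s\<close>; such a point and its branch witness \<open>R\<close>.\<close>
  have R: "R (take n q) (take n s)" if good: "good q s" and n: "length s \<le> length q" "n \<le> length s" for q s n
  proof -
    obtain x where x: "map x [0..<length q] = q" "x \<in> A' s"
      using good unfolding good_def avoidable_def by blast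
    then obtain f where f: "map f [0..<length s] = s" "R (map x [0..<n]) (map f [0..<n])"
      by (auto simp: A'_def)
    have "take n (map x [0..<length q]) = map x [0..<n]" "take n (map f [0..<length s]) = map f [0..<n]"
      using n by (auto simp: take_map)
    then show ?thesis using f x by simp
  qed
  have "avoidable W z A \<or> II_wins N W z A"
  proof (cases "good z []")
    case True
    show ?thesis unfolding A_def using II_wins_if_reach_later[where good = good and R = R and K = K, OF True later R] by blast
  next
    case False
    then have "avoidable U z A" by (simp add: good_def A'_Nil)
    then show ?thesis using avoidable_almost_subset[OF _ WU] by blast
  qed
  moreover have "W \<subseteq> V" using W(2) U(2) by blast
  ultimately show thesis using that W(1) by blast
qed

end

section \<open>Block subspaces\<close>

context vector_space_with_basis
begin

section \<open>Coordinates and supports\<close>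

abbreviation coef :: "'e \<Rightarrow> nat \<Rightarrow> 'f" where
  "coef x n \<equiv> representation (range e) x (e n)"

lemma in_span_basis: "x \<in> span (range e)"
  by (simp add: span_basis)

lemma finite_supp: "finite (supp x)"
proof -
  have "e ` supp x \<subseteq> {b. representation (range e) x b \<noteq> 0}" by (auto simp: supp_def)
  then have "finite (e ` supp x)" using finite_representation finite_subset by blast
  then show ?thesis using finite_imageD inj_basis inj_on_subset by blast
qed

lemma supp_eq_empty_iff: "supp x = {} \<longleftrightarrow> x = 0"
proof
  assume supp: "supp x = {}"
  have "representation (range e) x b = 0" for b
    using representation_ne_zero[of "range e" x b] supp by (auto simp: supp_def)
  then show "x = 0"
    using sum_nonzero_representation_eq[OF independent_basis in_span_basis, of x] by simp
qed (simp add: supp_def representation_zero)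

lemma subspace_supp_subset: "subspace {x. supp x \<subseteq> M}"
proof (rule subspaceI)
  fix x y assume "x \<in> {x. supp x \<subseteq> M}" "y \<in> {x. supp x \<subseteq> M}"
  moreover have "supp (x + y) \<subseteq> supp x \<union> supp y"
    by (auto simp: supp_def representation_add[OF independent_basis in_span_basis in_span_basis])
  ultimately show "x + y \<in> {x. supp x \<subseteq> M}" by blast
next
  fix c x assume "x \<in> {x. supp x \<subseteq> M}"
  moreover have "supp (scale c x) \<subseteq> supp x"
    by (auto simp: supp_def representation_scale[OF independent_basis in_span_basis])
  ultimately show "scale c x \<in> {x. supp x \<subseteq> M}" by blast
qed (simp add: supp_def representation_zero)

lemma supp_subset_if_in_span:
  assumes "x \<in> span S" "\<And>s. s \<in> S \<Longrightarrow> supp s \<subseteq> M"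
  shows "supp x \<subseteq> M"
  using span_minimal[OF _ subspace_supp_subset, of S M] assms by blast

lemma countable_UNIV_if_countable_field:
  assumes "countable (UNIV :: 'f set)"
  shows "countable (UNIV :: 'e set)"
proof -
  \<comment> \<open>Finite lists of coefficients and indices code all linear combinations.\<close>
  let ?v = "\<lambda>l. sum_list (map (\<lambda>(c, i). scale c (e i)) l)"
  have "subspace (range ?v)"
    unfolding subspace_def
  proof (intro conjI ballI allI)
    show "0 \<in> range ?v" by (rule range_eqI[of _ _ "[]"]) simp
  next
    fix x y assume "x \<in> range ?v" "y \<in> range ?v"
    then obtain l l' where "x = ?v l" "y = ?v l'" by blast
    then show "x + y \<in> range ?v" by (intro range_eqI[of _ _ "l @ l'"]) simp
  next
    fix c x assume "x \<in> range ?v"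
    then obtain l where x: "x = ?v l" by blast
    have "scale c (?v l) = ?v (map (\<lambda>(d, i). (c * d, i)) l)"
      by (induction l) (auto simp: scale_right_distrib)
    then show "scale c x \<in> range ?v" using x by blast
  qed
  moreover have "range e \<subseteq> range ?v"
  proof
    fix x assume "x \<in> range e"
    then obtain i where "x = e i" by blast
    then show "x \<in> range ?v" by (intro range_eqI[of _ _ "[(1, i)]"]) simp
  qed
  ultimately have "UNIV \<subseteq> range ?v" using span_minimal span_basis by metis
  moreover have "countable (lists (UNIV :: ('f \<times> nat) set))"
    using assms by (intro countable_lists) (metis UNIV_Times_UNIV countableI_type countable_SIGMA)
  then have "countable (range ?v)" by (intro countable_image) simp
  ultimately show ?thesis using countable_subset by blast
qed

section \<open>Block sequences, tails and pseudo-intersections\<close>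

lemma block_seq_supp_ne: "block_seq b \<Longrightarrow> supp (b i) \<noteq> {}"
  by (simp add: block_seq_def supp_eq_empty_iff)

lemma block_seq_less:
  assumes b: "block_seq b" and "i < j"
  shows "b i \<lless> b j"
  using assms(2)
proof (induction j rule: less_Suc_induct)
  case (1 i) then show ?case using b by (simp add: block_seq_def)
next
  case (2 i j k)
  \<comment> \<open>Transitivity of \<open>\<lless>\<close> needs a middle vector with non-empty
    support.\<close>
  then show ?case using block_seq_supp_ne[OF b, of j] unfolding block_less_def by (meson all_not_in_conv less_trans)
qed

lemma block_seq_supp_ge:
  assumes b: "block_seq b" and "n \<in> supp (b i)"
  shows "i \<le> n"
  using assms(2)
proof (induction i arbitrary: n)
  case (Suc i)
  obtain m where m: "m \<in> supp (b i)" using block_seq_supp_ne[OF b] by blast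
  have "m < n" using b Suc.prems m by (auto simp: block_seq_def block_less_def)
  then show ?case using Suc.IH[OF m] by simp
qed simp

text \<open>Without \<open>0\<close>, whose empty support would be beyond every number, all vectors are legal moves.\<close>

definition punctured_block_subspaces :: "'e set set" where
  "punctured_block_subspaces = (\<lambda>Y. Y - {0}) ` {Y. block_subspace Y}"

lemma punctured_block_subspacesI:
  "block_subspace Y \<Longrightarrow> Y - {0} \<in> punctured_block_subspaces"
  by (simp add: punctured_block_subspaces_def)

lemma ex_tail_block_subspace:
  assumes "Y \<in> punctured_block_subspaces"
  shows "\<exists>Z\<in>punctured_block_subspaces. Z \<subseteq> {y \<in> Y. nat_less n y}"
proof -
  obtain b where b: "block_seq b" and Y: "Y = span (range b) - {0}"
    using assms by (auto simp: punctured_block_subspaces_def block_subspace_def)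
  \<comment> \<open>Dropping \<open>Suc n\<close> blocks leaves supports strictly beyond
    \<open>n\<close>, as the block with index \<open>i\<close> starts at \<open>i\<close> or
    later.\<close>
  let ?b = "\<lambda>i. b (i + Suc n)"
  have "block_seq ?b" using b by (simp add: block_seq_def)
  then have Z: "span (range ?b) - {0} \<in> punctured_block_subspaces"
    by (intro punctured_block_subspacesI) (auto simp: block_subspace_def)
  have "span (range ?b) \<subseteq> span (range b)" by (intro span_mono) blast
  moreover have "nat_less n y" if "y \<in> span (range ?b)" for y
  proof -
    have "supp y \<subseteq> {n<..}"
      by (rule supp_subset_if_in_span[OF that]) (use block_seq_supp_ge[OF b] in fastforce)
    then show ?thesis by (auto simp: nat_less_def)
  qed
  ultimately have "span (range ?b) - {0} \<subseteq> {y \<in> Y. nat_less n y}" unfolding Y by blast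
  with Z show ?thesis by (rule bexI[rotated])
qed

lemma punctured_block_subspace_ne:
  assumes "Y \<in> punctured_block_subspaces"
  shows "Y \<noteq> {}"
proof -
  obtain b where b: "block_seq b" and Y: "Y = span (range b) - {0}"
    using assms by (auto simp: punctured_block_subspaces_def block_subspace_def)
  then have "b 0 \<in> Y" using span_base[of "b 0" "range b"] by (simp add: block_seq_def)
  then show ?thesis by blast
qed

text \<open>A vector of the span of a block sequence whose support avoids the first \<open>k\<close> blocks lies in
  the span of the later blocks.\<close>

lemma almost_contained_span_if_tail:
  assumes b: "block_seq b" and X: "subspace X" "\<And>i. k \<le> i \<Longrightarrow> b i \<in> X"
  shows "\<exists>n. \<forall>y\<in>span (range b). nat_less n y \<longrightarrow> y \<in> X"
proof -
  define M where "M = (\<Union>i<k. supp (b i))"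
  have "finite M" by (simp add: M_def finite_supp)
  then obtain n where n: "\<And>m. m \<in> M \<Longrightarrow> m \<le> n" by (auto simp: finite_nat_set_iff_bounded_le)
  have "y \<in> X" if y: "y \<in> span (range b)" "nat_less n y" for y
  proof -
    have "{..<k} \<union> {k..} = UNIV" by auto
    then have "range b = b ` {..<k} \<union> b ` {k..}" by (metis image_Un)
    then obtain u v where uv: "y = u + v" "u \<in> span (b ` {..<k})" "v \<in> span (b ` {k..})"
      using y(1) by (auto simp: span_Un)
    have u: "supp u \<subseteq> M" by (rule supp_subset_if_in_span[OF uv(2)]) (auto simp: M_def)
    have v: "supp v \<subseteq> - M"
    proof (rule supp_subset_if_in_span[OF uv(3)])
      fix s assume "s \<in> b ` {k..}"
      then obtain j where j: "s = b j" "k \<le> j" by blast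
      have "m \<notin> supp (b j)" if "i < k" "m \<in> supp (b i)" for i m
        using block_seq_less[OF b, of i j] that j(2) unfolding block_less_def by fastforce
      then show "supp s \<subseteq> - M" unfolding j(1) M_def by blast
    qed
    \<comment> \<open>The early part \<open>u\<close> lives on \<open>M\<close>, where both
      \<open>y\<close> and the late part \<open>v\<close> vanish; hence \<open>u\<close> is
      \<open>0\<close>.\<close>
    have "coef u m = 0" if "m \<in> M" for m
    proof -
      have "coef y m = coef u m + coef v m"
        unfolding uv(1) by (simp add: representation_add[OF independent_basis in_span_basis in_span_basis])
      moreover have "m \<notin> supp y" "m \<notin> supp v"
        using that n[OF that] y(2) v by (auto simp: nat_less_def)
      ultimately show ?thesis by (simp add: supp_def)
    qed
    then have "supp u = {}" using u by (auto simp: supp_def)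
    then have "y = v" using uv(1) by (simp add: supp_eq_empty_iff)
    moreover have "span (b ` {k..}) \<subseteq> X" using X by (intro span_minimal) auto
    ultimately show ?thesis using uv(3) by blast
  qed
  then show ?thesis by blast
qed

text \<open>A generic sequence of vectors that is eventually a block sequence and eventually lies in
  each \<open>X\<close> of the chain; its span is almost contained in each of them.\<close>

lemma ex_pseudo_intersection_block_subspaces:
  assumes MA: "martins_axiom_aleph1 TYPE(nat set)"
    and ctbl: "countable (UNIV :: 'f set)"
    and C: "C \<subseteq> punctured_block_subspaces" "C \<noteq> {}" "|C| \<le>o cardSuc natLeq"
    and chain: "\<And>X Y. X \<in> C \<Longrightarrow> Y \<in> C \<Longrightarrow>
      (\<exists>n. \<forall>y\<in>X. nat_less n y \<longrightarrow> y \<in> Y) \<or> (\<exists>n. \<forall>y\<in>Y. nat_less n y \<longrightarrow> y \<in> X)"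
  shows "\<exists>Z\<in>punctured_block_subspaces. \<forall>X\<in>C. \<exists>n. \<forall>y\<in>Z. nat_less n y \<longrightarrow> y \<in> X"
proof -
  \<comment> \<open>The promise \<open>None\<close> asks for non-zero blocks in increasing order,
    the promise \<open>Some X\<close> for vectors of \<open>X\<close>.\<close>
  define R where "R p s x \<longleftrightarrow> (case p of None \<Rightarrow> x \<noteq> 0 \<and> (\<forall>y\<in>set s. y \<lless> x) | Some X \<Rightarrow> x \<in> X)"
    for p s x
  have mono: "nat_less m y \<Longrightarrow> n \<le> m \<Longrightarrow> nat_less n y" for m n y by (auto simp: nat_less_def)
  \<comment> \<open>Finitely many members of the chain have one among them almost contained in all,
    with a common bound \<open>n\<close>; the extra member of \<open>C\<close> covers an empty
    \<open>F\<close>.\<close>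
  have common: "\<exists>Z\<in>C. \<exists>n. \<forall>X\<in>F. \<forall>y\<in>Z. nat_less n y \<longrightarrow> y \<in> X" if "finite F" "F \<subseteq> C" for F
    using that
  proof (induction F)
    case empty then show ?case using C(2) by blast
  next
    case (insert Y F)
    then obtain Z n where Z: "Z \<in> C" "\<forall>X\<in>F. \<forall>y\<in>Z. nat_less n y \<longrightarrow> y \<in> X" by blast
    from chain[OF Z(1), of Y] insert.prems consider m where "\<forall>y\<in>Z. nat_less m y \<longrightarrow> y \<in> Y"
      | m where "\<forall>y\<in>Y. nat_less m y \<longrightarrow> y \<in> Z" by blast
    then show ?case
    proof cases
      case 1
      have "\<forall>X\<in>insert Y F. \<forall>y\<in>Z. nat_less (max m n) y \<longrightarrow> y \<in> X"
        using 1 Z(2) mono[OF _ max.cobounded1] mono[OF _ max.cobounded2] by blast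
      then show ?thesis using Z(1) by blast
    next
      case 2
      have "\<forall>X\<in>insert Y F. \<forall>y\<in>Y. nat_less (max m n) y \<longrightarrow> y \<in> X"
        using 2 Z(2) mono[OF _ max.cobounded1] mono[OF _ max.cobounded2] by blast
      then show ?thesis using insert.prems by blast
    qed
  qed
  have ext: "\<exists>x. \<forall>p\<in>F. R p s x" if F: "finite F" "F \<subseteq> insert None (Some ` C)" for F s
  proof -
    have "finite (Some -` F)" "Some -` F \<subseteq> C" using F by (auto intro: finite_vimageI)
    then obtain Z n where Z: "Z \<in> C" "\<forall>X\<in>Some -` F. \<forall>y\<in>Z. nat_less n y \<longrightarrow> y \<in> X"
      using common by blast
    have "finite (\<Union>y\<in>set s. supp y)" by (simp add: finite_supp)
    then obtain m where m: "\<And>y i. y \<in> set s \<Longrightarrow> i \<in> supp y \<Longrightarrow> i \<le> m"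
      unfolding finite_nat_set_iff_bounded_le by blast
    obtain Y where Y: "Y \<in> punctured_block_subspaces" "Y \<subseteq> {y \<in> Z. nat_less (max m n) y}"
      using ex_tail_block_subspace[of Z "max m n"] Z(1) C(1) by blast
    obtain x where x: "x \<in> Y" using punctured_block_subspace_ne[OF Y(1)] by blast
    have "x \<noteq> 0" using x Y(1) by (auto simp: punctured_block_subspaces_def)
    moreover have "nat_less m x" "nat_less n x"
      using x Y(2) mono[OF _ max.cobounded1] mono[OF _ max.cobounded2] by blast+
    ultimately have "R p s x" if "p \<in> F" for p
      using that Z(2) x Y(2) m
      by (cases p) (fastforce simp: R_def block_less_def nat_less_def, auto simp: R_def)
    then show ?thesis by blast
  qed
  have "|{None} \<union> Some ` C| \<le>o cardSuc natLeq"
    by (intro card_of_Un_le_aleph1 card_of_image_le_aleph1 C(3)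
        card_of_le_aleph1_if_countable[of "{None}"]) simp
  then have card: "|insert None (Some ` C)| \<le>o cardSuc natLeq" by simp
  obtain b where b: "\<And>p. p \<in> insert None (Some ` C) \<Longrightarrow> \<exists>k. \<forall>i\<ge>k. R p (map b [0..<i]) (b i)"
    by (rule MA_generic_sequence[where R = R, OF MA countable_UNIV_if_countable_field[OF ctbl] card])
      (rule ext, assumption+, rule that)
  \<comment> \<open>The promise \<open>None\<close> holds only from \<open>l\<close> on, so the
    terms before \<open>l\<close> are dropped.\<close>
  obtain l where l: "\<And>i. l \<le> i \<Longrightarrow> b i \<noteq> 0 \<and> (\<forall>j<i. b j \<lless> b i)"
    using b[of None] by (fastforce simp: R_def)
  define b' where "b' i = b (l + i)" for i
  have b': "block_seq b'" using l by (simp add: block_seq_def b'_def)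
  then have "span (range b') - {0} \<in> punctured_block_subspaces"
    by (intro punctured_block_subspacesI) (auto simp: block_subspace_def)
  moreover have "\<exists>n. \<forall>y\<in>span (range b') - {0}. nat_less n y \<longrightarrow> y \<in> X" if X: "X \<in> C" for X
  proof -
    obtain Y where Y: "block_subspace Y" "X = Y - {0}"
      using X C(1) by (auto simp: punctured_block_subspaces_def)
    obtain k where "\<And>i. k \<le> i \<Longrightarrow> b i \<in> X" using b[of "Some X"] X by (auto simp: R_def)
    then have "\<And>i. k \<le> i \<Longrightarrow> b' i \<in> Y" using Y(2) by (simp add: b'_def)
    moreover have "subspace Y" using Y(1) by (auto simp: block_subspace_def)
    ultimately show ?thesis using almost_contained_span_if_tail[OF b'] Y(2) by blast
  qed
  ultimately show ?thesis by blast
qed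

end

section \<open>Transfer to the games with block subspaces\<close>

theorem corollary11:
  fixes scale :: "'f::field \<Rightarrow> 'e::ab_group_add \<Rightarrow> 'e"
    and e :: "nat \<Rightarrow> 'e"
    and \<A> :: "(nat \<Rightarrow> 'e) set"
  assumes "martins_axiom_aleph1 TYPE(nat set)"
    and "countable (UNIV :: 'f set)"
    and "vector_space_with_basis scale e"
    and "Sigma_1_2_in (seq_topology :: (nat \<Rightarrow> 'e) topology) \<A>"
  shows "vector_space_with_basis.strategically_Ramsey scale e \<A>"
proof -
  interpret vector_space_with_basis scale e by fact
  interpret asymptotic_game punctured_block_subspaces nat_less
  proof
    show "martins_axiom_aleph1 TYPE(nat set)" by fact
    show "countable (UNIV :: 'e set)" using assms(2) by (rule countable_UNIV_if_countable_field)
    show "m \<le> n \<Longrightarrow> nat_less n x \<Longrightarrow> nat_less m x" for m n x by (auto simp: nat_less_def)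
  qed (rule ex_tail_block_subspace, assumption,
      rule ex_pseudo_intersection_block_subspaces[OF assms(1,2)])
  obtain K :: "(nat \<times> nat set) set" and R where K: "|K| \<le>o cardSuc natLeq"
    and \<A>: "\<A> = {x. \<exists>f. (\<forall>n. f n \<in> K) \<and> (\<forall>n. R (map x [0..<n]) (map f [0..<n]))}"
    using Sigma_1_2_in_souslin[OF assms(4)] .
  \<comment> \<open>The largest index in the supports of the position, \<open>0\<close> if there is
    none; a vector beyond it comes after every vector played.\<close>
  define N where "N q = Max (insert 0 (\<Union>y\<in>set q. supp y))" for q
  have N: "m \<le> N q" if "y \<in> set q" "m \<in> supp y" for y q m
    unfolding N_def using that finite_supp by (intro Max_ge) auto
  show ?thesis
    unfolding strategically_Ramsey_def
  proof (intro allI impI)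
    fix V z assume "block_subspace V"
    then have V: "V - {0} \<in> punctured_block_subspaces" by (rule punctured_block_subspacesI)
    obtain W' where W': "W' \<in> punctured_block_subspaces" "W' \<subseteq> V - {0}"
      and wins: "avoidable W' z \<A> \<or> II_wins N W' z \<A>"
      unfolding \<A> by (rule souslin_dichotomy[OF V K])
    obtain W where W: "block_subspace W" "W' = W - {0}"
      using W'(1) by (auto simp: punctured_block_subspaces_def)
    have "0 \<in> V" using \<open>block_subspace V\<close> by (auto simp: block_subspace_def span_zero)
    then have "W \<subseteq> V" using W'(2) W(2) by blast
    moreover have "II_has_strategy_G W z \<A>" if wins: "II_wins N W' z \<A>"
    proof -
      obtain \<sigma> where \<sigma>: "\<forall>Y x. (\<forall>i. Y i \<in> punctured_block_subspaces \<and> Y i \<subseteq> W') \<longrightarrow>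
          (\<forall>i. x i = \<sigma> (map Y [0..<Suc i])) \<longrightarrow>
          (\<forall>i. x i \<in> Y i \<and> nat_less (N (z @ map x [0..<i])) (x i)) \<and> z \<frown> x \<in> \<A>"
        using wins unfolding II_wins_def by blast
      show ?thesis
        unfolding II_has_strategy_G_def
      \<comment> \<open>II removes \<open>0\<close> from the subspaces of I and consults the
        abstract strategy.\<close>
      proof (intro exI[of _ "\<lambda>Ys. \<sigma> (map (\<lambda>Y. Y - {0}) Ys)"] allI impI)
        fix Y x assume Y: "\<forall>i. block_subspace (Y i) \<and> Y i \<subseteq> W"
          and x: "\<forall>i. x i = \<sigma> (map (\<lambda>Y. Y - {0}) (map Y [0..<Suc i]))"
        have run: "(\<forall>i. x i \<in> Y i - {0} \<and> nat_less (N (z @ map x [0..<i])) (x i)) \<and> z \<frown> x \<in> \<A>"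
        proof (rule \<sigma>[THEN spec, THEN spec, THEN mp, THEN mp]; intro allI)
          show "Y i - {0} \<in> punctured_block_subspaces \<and> Y i - {0} \<subseteq> W'" for i
            using Y W(2) punctured_block_subspacesI by blast
          show "x i = \<sigma> (map (\<lambda>i. Y i - {0}) [0..<Suc i])" for i
            using x by (simp add: comp_def)
        qed
        moreover have "x i \<lless> x (Suc i)" for i
        proof -
          have "nat_less (N (z @ map x [0..<Suc i])) (x (Suc i))" using run by blast
          moreover have "m \<le> N (z @ map x [0..<Suc i])" if "m \<in> supp (x i)" for m
            by (rule N[OF _ that]) simp
          ultimately show ?thesis unfolding block_less_def nat_less_def by (meson le_less_trans)
        qed
        ultimately show "(\<forall>i. x i \<noteq> 0 \<and> x i \<in> Y i \<and> x i \<lless> x (Suc i)) \<and> z \<frown> x \<in> \<A>" by blast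
      qed
    qed
    moreover have "I_has_strategy_F W z (- \<A>)" if avoidable: "avoidable W' z \<A>"
    proof -
      obtain g where g: "\<And>x. map x [0..<length z] = z \<Longrightarrow>
          (\<And>i. length z \<le> i \<Longrightarrow> x i \<in> W' \<and> nat_less (g (map x [0..<i])) (x i)) \<Longrightarrow> x \<notin> \<A>"
        using avoidable unfolding avoidable_def by blast
      \<comment> \<open>Summing over all prefixes keeps the value at least that of \<open>g\<close>
        at the current position, and \<open>Suc\<close> makes the moves of I strictly
        increasing.\<close>
      define \<tau> where "\<tau> xs = (\<Sum>j\<le>length xs. Suc (g (z @ take j xs)))" for xs
      show ?thesis
        unfolding I_has_strategy_F_def
      proof (intro exI[of _ \<tau>] allI impI conjI)
        fix n x i assume n: "\<forall>i. n i = \<tau> (map x [0..<i])"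
        have n_eq: "n i = (\<Sum>j\<le>i. Suc (g (z @ map x [0..<j])))" for i
          by (simp add: n \<tau>_def take_map min_def)
        show "n i < n (Suc i)" by (simp add: n_eq)
      next
        fix n x assume n: "\<forall>i. n i = \<tau> (map x [0..<i])"
          and x: "\<forall>i. x i \<noteq> 0 \<and> x i \<in> W \<and> nat_less (n i) (x i) \<and> x i \<lless> x (Suc i)"
        have prefix: "map (z \<frown> x) [0..<length z + j] = z @ map x [0..<j]" for j
          by (intro nth_equalityI) (auto simp: nth_append conc_def)
        have "z \<frown> x \<notin> \<A>"
        proof (rule g)
          show "map (z \<frown> x) [0..<length z] = z" using prefix[of 0] by simp
        next
          fix i assume "length z \<le> i"
          then obtain j where i: "i = length z + j" using le_Suc_ex by blast
          have "g (z @ map x [0..<j]) \<le> \<tau> (map x [0..<j])"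
            unfolding \<tau>_def
            using member_le_sum[of j "{..j}" "\<lambda>k. Suc (g (z @ take k (map x [0..<j])))"] by simp
          then have "nat_less (g (z @ map x [0..<j])) (x j)"
            using x n unfolding nat_less_def by (metis le_less_trans)
          then show "(z \<frown> x) i \<in> W' \<and> nat_less (g (map (z \<frown> x) [0..<i])) ((z \<frown> x) i)"
            using x W(2) unfolding i prefix by simp
        qed
        then show "z \<frown> x \<in> - \<A>" by simp
      qed
    qed
    ultimately show "\<exists>W. block_subspace W \<and> W \<subseteq> V \<and>
        (II_has_strategy_G W z \<A> \<or> I_has_strategy_F W z (- \<A>))"
      using W(1) wins by blast
  qed
qed

end
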